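(* Let $s \in (0,1)$. Then for all $x,y \in V$ and all $z \in \mathbb{C}\setminus\mathbb{R}$, \[ \mathbb{E}\bigl\{ |G_\omega(z;x,y)|^s \bigr\} \le C'\, C^{d(x,y)}\, c_x(d(x,y)), \] where \[ C := \lambda^{-s}\,\|\rho\|_\infty^s\,\frac{2^s s^{-s}}{1-s}\qquad\text{and}\qquad C' := 2^{s+1} C . \]
   Context: Graph: $G=(V,E)$ is an infinite, locally finite, connected (undirected) graph without loops or multiple edges; $x\sim y$ means that $x$ and $y$ are joined by an edge; $m(x)=\#\{y\in V: y\sim x\}<\infty$ is the valence of $x$ (not assumed uniformly bounded); $d(x,y)$ is the graph distance. For $n\in\mathbb{N}$, $c_x(n)$ is the number of self-avoiding walks (walks that never visit a vertex twice) of length $n$ (number of edges) starting at $x$, and $c_x(0)=1$. Operator: On $\ell^2(V)$ (counting measure) let $(\Delta_{\rm c}\psi)(x) = -m(x)\psi(x)+\sum_{y\sim x}\psi(y)$ for finitely supported $\psi$. This operator is essentially selfadjoint (known fact), and $\Delta$ denotes its unique selfadjoint extension, with domain $D(\Delta)$. The random potential is $(V_\omega\psi)(x)=\omega_x\psi(x)$, where $\{\omega_x\}_{x\in V}$ are independent identically distributed real random variables, each with probability density $\rho\in L^\infty(\mathbb{R})\cap L^1(\mathbb{R})$ such that $\{t\in\mathbb{R}:\rho(t)\neq 0\}$ is bounded. $\mathbb{E}$ denotes expectation. For a disorder parameter $\lambda>0$ let $H_\omega=-\Delta+\lambda V_\omega$ on $D(\Delta)$, which is selfadjoint. The Green function is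 $G_\omega(z;x,y)=\langle\delta_x,(H_\omega-z)^{-1}\delta_y\rangle$ for $z\in\mathbb{C}\setminus\mathbb{R}$, where $\delta_x$ is the function equal to $1$ at $x$ and $0$ elsewhere. *)

theory Defs
  imports "HOL-Probability.Probability"
begin

text \<open>A simple graph is a symmetric irreflexive adjacency relation; the vertex set is the whole
  type. A walk with \<open>n\<close> edges is a list of \<open>Suc n\<close> vertices.\<close>

definition simple_graph :: "('v \<Rightarrow> 'v \<Rightarrow> bool) \<Rightarrow> bool" where
  "simple_graph adj \<longleftrightarrow> symp adj \<and> irreflp adj"

definition locally_finite_graph :: "('v \<Rightarrow> 'v \<Rightarrow> bool) \<Rightarrow> bool" where
  "locally_finite_graph adj \<longleftrightarrow> (\<forall>x. finite {y. adj x y})"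

definition walks :: "('v \<Rightarrow> 'v \<Rightarrow> bool) \<Rightarrow> 'v \<Rightarrow> nat \<Rightarrow> 'v list set" where
  "walks adj x n = {xs. length xs = Suc n \<and> hd xs = x \<and> successively adj xs}"

definition connected_graph :: "('v \<Rightarrow> 'v \<Rightarrow> bool) \<Rightarrow> bool" where
  "connected_graph adj \<longleftrightarrow> (\<forall>x y. \<exists>n. \<exists>xs \<in> walks adj x n. last xs = y)"

definition valence :: "('v \<Rightarrow> 'v \<Rightarrow> bool) \<Rightarrow> 'v \<Rightarrow> nat" where
  "valence adj x = card {y. adj x y}"

definition graph_dist :: "('v \<Rightarrow> 'v \<Rightarrow> bool) \<Rightarrow> 'v \<Rightarrow> 'v \<Rightarrow> nat" where
  "graph_dist adj x y = (LEAST n. \<exists>xs \<in> walks adj x n. last xs = y)"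

definition saw_count :: "('v \<Rightarrow> 'v \<Rightarrow> bool) \<Rightarrow> 'v \<Rightarrow> nat \<Rightarrow> nat" where
  "saw_count adj x n = card {xs \<in> walks adj x n. distinct xs}"

text \<open>The Hilbert space \<open>\<ell>\<^sup>2(V)\<close>; the inner product is linear in the second argument.\<close>

definition ell2 :: "('v \<Rightarrow> complex) set" where
  "ell2 = {\<psi>. (\<lambda>x. (cmod (\<psi> x))\<^sup>2) summable_on UNIV}"

definition ell2_inner :: "('v \<Rightarrow> complex) \<Rightarrow> ('v \<Rightarrow> complex) \<Rightarrow> complex" where
  "ell2_inner \<phi> \<psi> = (\<Sum>\<^sub>\<infinity>x. cnj (\<phi> x) * \<psi> x)"

definition ell2_norm :: "('v \<Rightarrow> complex) \<Rightarrow> real" where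
  "ell2_norm \<psi> = sqrt (\<Sum>\<^sub>\<infinity>x. (cmod (\<psi> x))\<^sup>2)"

definition delta :: "'v \<Rightarrow> 'v \<Rightarrow> complex" where
  "delta x = (\<lambda>y. if y = x then 1 else 0)"

text \<open>An unbounded operator \<open>A\<close> is represented by its graph, the set of all pairs \<open>(\<psi>, A \<psi>)\<close> with
  \<open>\<psi>\<close> in the domain. Its domain is \<open>Domain A\<close>, extension of operators is set inclusion and the
  inverse is the converse relation.\<close>

type_synonym 'v operator = "(('v \<Rightarrow> complex) \<times> ('v \<Rightarrow> complex)) set"

definition densely_defined :: "'v operator \<Rightarrow> bool" where
  "densely_defined A \<longleftrightarrow>
     Domain A \<subseteq> ell2 \<and> (\<forall>\<phi>\<in>ell2. \<forall>\<epsilon>>0. \<exists>\<psi>\<in>Domain A. ell2_norm (\<lambda>x. \<phi> x - \<psi> x) < \<epsilon>)"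

definition adjoint_op :: "'v operator \<Rightarrow> 'v operator" where
  "adjoint_op A = {(\<phi>, \<eta>). \<phi> \<in> ell2 \<and> \<eta> \<in> ell2 \<and>
     (\<forall>(\<psi>, \<theta>)\<in>A. ell2_inner \<phi> \<theta> = ell2_inner \<eta> \<psi>)}"

text \<open>The adjoint of a densely defined relation is the graph of a linear map between subspaces of
  \<open>ell2\<close>, so linearity and single-valuedness need not be demanded separately.\<close>

definition selfadjoint_op :: "'v operator \<Rightarrow> bool" where
  "selfadjoint_op A \<longleftrightarrow> densely_defined A \<and> adjoint_op A = A"

definition laplacian_c :: "('v \<Rightarrow> 'v \<Rightarrow> bool) \<Rightarrow> 'v operator" where
  "laplacian_c adj =
     {(\<psi>, \<lambda>x. - of_nat (valence adj x) * \<psi> x + (\<Sum>y | adj x y. \<psi> y)) |\<psi>. finite {x. \<psi> x \<noteq> 0}}"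

definition laplacian :: "('v \<Rightarrow> 'v \<Rightarrow> bool) \<Rightarrow> 'v operator" where
  "laplacian adj = (THE A. selfadjoint_op A \<and> laplacian_c adj \<subseteq> A)"

text \<open>The potential \<open>v\<close> is a sample \<open>x \<mapsto> \<omega>\<^sub>x\<close>. The domain is that of the Laplacian; this is a
  selfadjoint operator when \<open>v\<close> is bounded, hence for almost every sample in the situation of
  interest.\<close>

definition anderson_op :: "('v \<Rightarrow> 'v \<Rightarrow> bool) \<Rightarrow> real \<Rightarrow> ('v \<Rightarrow> real) \<Rightarrow> 'v operator" where
  "anderson_op adj lam v =
     {(\<psi>, \<lambda>x. - \<theta> x + of_real (lam * v x) * \<psi> x) |\<psi> \<theta>. (\<psi>, \<theta>) \<in> laplacian adj}"

definition shift_op :: "'v operator \<Rightarrow> complex \<Rightarrow> 'v operator" where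
  "shift_op A z = {(\<psi>, \<lambda>x. \<theta> x - z * \<psi> x) |\<psi> \<theta>. (\<psi>, \<theta>) \<in> A}"

definition apply_op :: "'v operator \<Rightarrow> ('v \<Rightarrow> complex) \<Rightarrow> ('v \<Rightarrow> complex)" where
  "apply_op A \<psi> = (THE \<theta>. (\<psi>, \<theta>) \<in> A)"

definition green ::
  "('v \<Rightarrow> 'v \<Rightarrow> bool) \<Rightarrow> real \<Rightarrow> ('v \<Rightarrow> real) \<Rightarrow> complex \<Rightarrow> 'v \<Rightarrow> 'v \<Rightarrow> complex" where
  "green adj lam v z x y =
     ell2_inner (delta x) (apply_op ((shift_op (anderson_op adj lam v) z)\<inverse>) (delta y))"

definition Linf_norm :: "(real \<Rightarrow> real) \<Rightarrow> ereal" where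
  "Linf_norm f = esssup lborel (\<lambda>t. ereal \<bar>f t\<bar>)"

end

theory Submission
  imports Defs
begin

text \<open>In a finite box the Green function is obtained by adding one vertex at a time. Adding \<open>a\<close> is a
  rank one update with denominator \<open>\<lambda> \<omega>\<^sub>a - \<alpha>\<close>, where \<open>\<alpha>\<close> does not depend on \<open>\<omega>\<^sub>a\<close>, so averaging over
  \<open>\<omega>\<^sub>a\<close> costs one factor \<open>C\<close> and leaves \<open>\<Sum>\<^sub>b |G(b,y)|\<^sup>s\<close> over the neighbours \<open>b\<close> of \<open>a\<close> in the box
  without \<open>a\<close>. As long as \<open>y\<close> is not reached this can be repeated, and \<open>d(x,y)\<close> repetitions produce a
  sum over self-avoiding walks of that length. The remaining moments are at most \<open>C'\<close>, by averaging
  over the potential at the two vertices involved.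

  The infinite graph is reached by exhaustion. Finite-volume solutions are bounded in \<open>\<ell>\<^sup>2\<close>, hence
  precompact for pointwise convergence, and converge as soon as the limiting equation has at most one
  \<open>\<ell>\<^sup>2\<close> solution. For \<open>-\<Delta> + 1 \<plusminus> \<i>\<close> uniqueness is a maximum principle; it yields the symmetry of the
  maximal Laplacian, i.e. essential selfadjointness, and this in turn gives uniqueness for \<open>H\<^sub>\<omega> - z\<close>.
  The convergence makes the Green function measurable up to null sets, and Fatou's lemma
  transfers the bound.\<close>

section \<open>Green functions of finite sections\<close>

locale lf_graph =
  fixes adj :: "'v \<Rightarrow> 'v \<Rightarrow> bool"
  assumes adj_sym: "adj x y \<Longrightarrow> adj y x"
    and adj_irrefl: "\<not> adj x x"
    and finite_nbrs: "finite {y. adj x y}"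
begin

lemma adj_commute: "adj x y \<longleftrightarrow> adj y x"
  using adj_sym by blast

text \<open>Multiplication by \<open>d\<close> minus the adjacency operator, acting on arbitrary
  functions with no domain attached. With \<open>d\<close> the valence it is the formal -\<Delta>,
  and adding \<open>lam * v x - z\<close> to the valence gives H - z.\<close>

definition hop :: "('v \<Rightarrow> complex) \<Rightarrow> ('v \<Rightarrow> complex) \<Rightarrow> 'v \<Rightarrow> complex" where
  "hop d \<phi> x = d x * \<phi> x - (\<Sum>y | adj x y. \<phi> y)"

lemma hop_add: "hop d (\<lambda>x. \<phi> x + \<psi> x) x = hop d \<phi> x + hop d \<psi> x"
  by (simp add: hop_def algebra_simps sum.distrib)

lemma hop_diff: "hop d (\<lambda>x. \<phi> x - \<psi> x) x = hop d \<phi> x - hop d \<psi> x"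
  by (simp add: hop_def algebra_simps sum_subtractf)

lemma hop_scale: "hop d (\<lambda>x. \<phi> x * c) x = hop d \<phi> x * c"
  by (simp add: hop_def algebra_simps sum_distrib_left)

lemma hop_sum:
  assumes "finite I"
  shows "hop d (\<lambda>x. \<Sum>i\<in>I. \<phi> i x) x = (\<Sum>i\<in>I. hop d (\<phi> i) x)"
  using assms by induction (simp_all add: hop_add, simp add: hop_def)

text \<open>For functions supported in \<open>\<Lambda>\<close> the hopping term is a double sum
  over \<open>\<Lambda>\<close> with a real symmetric kernel, so only the diagonal gets
  conjugated.\<close>

lemma hop_symmetric:
  assumes "finite \<Lambda>" "\<And>x. x \<notin> \<Lambda> \<Longrightarrow> \<phi> x = 0" "\<And>x. x \<notin> \<Lambda> \<Longrightarrow> \<psi> x = 0"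
  shows "(\<Sum>x\<in>\<Lambda>. cnj (\<phi> x) * hop d \<psi> x) = (\<Sum>x\<in>\<Lambda>. cnj (hop (\<lambda>x. cnj (d x)) \<phi> x) * \<psi> x)"
proof -
  have nb: "(\<Sum>y | adj x y. f y) = (\<Sum>y\<in>\<Lambda>. if adj x y then f y else 0)"
    if "\<And>y. y \<notin> \<Lambda> \<Longrightarrow> f y = 0" for f :: "'v \<Rightarrow> complex" and x
  proof -
    have "(\<Sum>y | adj x y. f y) = (\<Sum>y\<in>{y. adj x y} \<inter> \<Lambda>. f y)"
      using that by (intro sum.mono_neutral_right finite_nbrs) auto
    also have "\<dots> = (\<Sum>y\<in>\<Lambda>. if adj x y then f y else 0)"
      using assms(1) by (intro sum.mono_neutral_cong_left) auto
    finally show ?thesis .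
  qed
  have "(\<Sum>x\<in>\<Lambda>. \<Sum>y\<in>\<Lambda>. cnj (\<phi> x) * (if adj x y then \<psi> y else 0))
      = (\<Sum>y\<in>\<Lambda>. \<Sum>x\<in>\<Lambda>. cnj (\<phi> x) * (if adj x y then \<psi> y else 0))"
    by (rule sum.swap)
  also have "\<dots> = (\<Sum>x\<in>\<Lambda>. \<Sum>y\<in>\<Lambda>. cnj (if adj x y then \<phi> y else 0) * \<psi> x)"
    using adj_commute by (intro sum.cong refl) (auto simp: adj_commute)
  finally show ?thesis
    using assms by (simp add: hop_def nb algebra_simps sum_subtractf sum_distrib_left
        sum_distrib_right cong: if_cong)
qed

text \<open>The hopping term contributes a real number to the quadratic form, so only the constant
  imaginary part of \<open>d\<close> survives.\<close>

lemma hop_energy: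
  assumes "finite \<Lambda>" "\<And>x. x \<notin> \<Lambda> \<Longrightarrow> \<phi> x = 0" "\<And>x. x \<in> \<Lambda> \<Longrightarrow> Im (d x) = e"
  shows "Im (\<Sum>x\<in>\<Lambda>. cnj (\<phi> x) * hop d \<phi> x) = e * (\<Sum>x\<in>\<Lambda>. (cmod (\<phi> x))\<^sup>2)"
proof -
  define S where "S = (\<Sum>x\<in>\<Lambda>. cnj (\<phi> x) * hop d \<phi> x)"
  have *: "hop (\<lambda>x. cnj (d x)) \<phi> x = hop d \<phi> x - 2 * \<i> * e * \<phi> x" if "x \<in> \<Lambda>" for x
  proof -
    have "cnj (d x) = d x - 2 * \<i> * e"
      using assms(3)[OF that] by (simp add: complex_eq_iff)
    then show ?thesis by (simp only: hop_def) (simp add: algebra_simps)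
  qed
  have "S = (\<Sum>x\<in>\<Lambda>. cnj (hop (\<lambda>x. cnj (d x)) \<phi> x) * \<phi> x)"
    unfolding S_def by (intro hop_symmetric assms)
  also have "\<dots> = (\<Sum>x\<in>\<Lambda>. cnj (cnj (\<phi> x) * hop d \<phi> x) + 2 * \<i> * e * (cmod (\<phi> x))\<^sup>2)"
    by (intro sum.cong refl)
      (simp add: * algebra_simps complex_norm_square[unfolded of_real_power])
  also have "\<dots> = cnj S + 2 * \<i> * e * (\<Sum>x\<in>\<Lambda>. (cmod (\<phi> x))\<^sup>2)"
    by (simp add: sum.distrib S_def sum_distrib_left)
  finally have "Im S = Im (cnj S + 2 * \<i> * e * (\<Sum>x\<in>\<Lambda>. (cmod (\<phi> x))\<^sup>2))" by (rule arg_cong)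
  then have "Im S = e * (\<Sum>x\<in>\<Lambda>. (cmod (\<phi> x))\<^sup>2)" by simp
  then show ?thesis by (simp only: S_def)
qed

section \<open>Dirichlet problems on finite vertex sets\<close>

definition fv_sol :: "('v \<Rightarrow> complex) \<Rightarrow> 'v set \<Rightarrow> ('v \<Rightarrow> complex) \<Rightarrow> ('v \<Rightarrow> complex) \<Rightarrow> bool" where
  "fv_sol d \<Lambda> f \<phi> \<longleftrightarrow> (\<forall>x. x \<notin> \<Lambda> \<longrightarrow> \<phi> x = 0) \<and> (\<forall>x\<in>\<Lambda>. hop d \<phi> x = f x)"

text \<open>This is the resolvent bound 1 / |Im z|: pair the equation with \<open>\<phi>\<close>,
  take imaginary parts, apply Cauchy-Schwarz and cancel one factor of the norm.\<close>

lemma fv_sol_norm_le: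
  assumes "finite \<Lambda>" "\<And>x. x \<in> \<Lambda> \<Longrightarrow> Im (d x) = e" "fv_sol d \<Lambda> f \<phi>"
  shows "\<bar>e\<bar> * L2_set (\<lambda>x. cmod (\<phi> x)) \<Lambda> \<le> L2_set (\<lambda>x. cmod (f x)) \<Lambda>"
proof -
  let ?L = "L2_set (\<lambda>x. cmod (\<phi> x)) \<Lambda>"
  have sq: "?L\<^sup>2 = (\<Sum>x\<in>\<Lambda>. (cmod (\<phi> x))\<^sup>2)"
    by (simp add: L2_set_def sum_nonneg)
  have "\<bar>e\<bar> * ?L\<^sup>2 = \<bar>Im (\<Sum>x\<in>\<Lambda>. cnj (\<phi> x) * hop d \<phi> x)\<bar>"
    using assms unfolding sq
    by (subst hop_energy[where e = e]) (auto simp: fv_sol_def abs_mult sum_nonneg)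
  also have "(\<Sum>x\<in>\<Lambda>. cnj (\<phi> x) * hop d \<phi> x) = (\<Sum>x\<in>\<Lambda>. cnj (\<phi> x) * f x)"
    using assms by (intro sum.cong) (auto simp: fv_sol_def)
  also have "\<bar>Im (\<Sum>x\<in>\<Lambda>. cnj (\<phi> x) * f x)\<bar> \<le> cmod (\<Sum>x\<in>\<Lambda>. cnj (\<phi> x) * f x)"
    by (rule abs_Im_le_cmod)
  also have "\<dots> \<le> (\<Sum>x\<in>\<Lambda>. cmod (\<phi> x) * cmod (f x))"
    by (rule order_trans[OF norm_sum]) (simp add: norm_mult)
  also have "\<dots> \<le> ?L * L2_set (\<lambda>x. cmod (f x)) \<Lambda>"
    using L2_set_mult_ineq[of "\<lambda>x. cmod (\<phi> x)" "\<lambda>x. cmod (f x)" \<Lambda>] by simp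
  finally have "?L * (\<bar>e\<bar> * ?L) \<le> ?L * L2_set (\<lambda>x. cmod (f x)) \<Lambda>"
    by (simp add: power2_eq_square mult_ac)
  moreover have "0 \<le> ?L" by (rule L2_set_nonneg)
  ultimately show ?thesis
    by (cases "?L = 0") (auto simp: mult_le_cancel_left L2_set_nonneg)
qed

lemma fv_sol_unique:
  assumes "finite \<Lambda>" "\<And>x. x \<in> \<Lambda> \<Longrightarrow> Im (d x) = e" "e \<noteq> 0"
    "fv_sol d \<Lambda> f \<phi>" "fv_sol d \<Lambda> f \<psi>"
  shows "\<phi> = \<psi>"
proof -
  have "fv_sol d \<Lambda> (\<lambda>_. 0) (\<lambda>x. \<phi> x - \<psi> x)"
    using assms by (auto simp: fv_sol_def hop_diff)
  from fv_sol_norm_le[OF assms(1,2) this]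
  have "\<bar>e\<bar> * L2_set (\<lambda>x. cmod (\<phi> x - \<psi> x)) \<Lambda> \<le> 0"
    by (simp add: L2_set_def)
  then have "L2_set (\<lambda>x. cmod (\<phi> x - \<psi> x)) \<Lambda> = 0"
    using assms(3) L2_set_nonneg[of "\<lambda>x. cmod (\<phi> x - \<psi> x)" \<Lambda>]
    by (simp add: mult_le_0_iff)
  then have "\<forall>x\<in>\<Lambda>. \<phi> x = \<psi> x"
    using assms(1) by (simp add: L2_set_eq_0_iff)
  then show ?thesis
    using assms(4,5) by (auto simp: fv_sol_def fun_eq_iff)
qed

section \<open>Green functions built by adding one vertex at a time\<close>

text \<open>The \<open>THE\<close> below is meaningful when \<open>Im d\<close> is a nonzero constant on the finite set \<open>\<Lambda>\<close>. For
  \<open>y\<close> outside \<open>\<Lambda>\<close> the right-hand side vanishes on \<open>\<Lambda>\<close>, so that the value is \<open>0\<close>.\<close>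

definition fgreen :: "('v \<Rightarrow> complex) \<Rightarrow> 'v set \<Rightarrow> 'v \<Rightarrow> 'v \<Rightarrow> complex" where
  "fgreen d \<Lambda> x y = (THE \<phi>. fv_sol d \<Lambda> (delta y) \<phi>) x"

text \<open>\<open>resp\<close> and \<open>schur\<close> are the vector and the scalar of the rank one update by which \<open>fgreen\<close>
  changes when the vertex \<open>a\<close> is added to \<open>\<Lambda>\<close>, see \<open>fgreen_insert\<close>.\<close>

definition resp :: "('v \<Rightarrow> complex) \<Rightarrow> 'v set \<Rightarrow> 'v \<Rightarrow> 'v \<Rightarrow> complex" where
  "resp d \<Lambda> a x = delta a x + (\<Sum>b | adj a b. fgreen d \<Lambda> x b)"

definition schur :: "('v \<Rightarrow> complex) \<Rightarrow> 'v set \<Rightarrow> 'v \<Rightarrow> complex" where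
  "schur d \<Lambda> a = d a - (\<Sum>b | adj a b. \<Sum>c | adj a c. fgreen d \<Lambda> b c)"

text \<open>This locality separates the potential at an added vertex from the Green function of the
  old set.\<close>

lemma fgreen_cong:
  assumes "\<And>x. x \<in> \<Lambda> \<Longrightarrow> d x = d' x"
  shows "fgreen d \<Lambda> = fgreen d' \<Lambda>"
proof -
  have "fv_sol d \<Lambda> f \<phi> = fv_sol d' \<Lambda> f \<phi>" for f \<phi>
    using assms by (simp add: fv_sol_def hop_def)
  then show ?thesis by (simp add: fgreen_def fun_eq_iff)
qed

lemma fv_sol_fgreen_if:
  assumes "finite \<Lambda>" "\<And>x. x \<in> \<Lambda> \<Longrightarrow> Im (d x) = e" "e \<noteq> 0" "fv_sol d \<Lambda> (delta y) \<phi>"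
  shows "fgreen d \<Lambda> x y = \<phi> x"
proof -
  have "(THE \<phi>. fv_sol d \<Lambda> (delta y) \<phi>) = \<phi>"
    using assms(4) fv_sol_unique[OF assms(1-3) _ assms(4)] by (rule the_equality)
  then show ?thesis by (simp add: fgreen_def)
qed

lemma fv_sol_empty: "fv_sol d {} f (\<lambda>_. 0)"
  by (simp add: fv_sol_def)

lemma fgreen_empty: "fgreen d {} x y = 0"
  by (rule fv_sol_fgreen_if[where e = 1]) (auto simp: fv_sol_empty)

lemma sum_delta_nbrs:
  "(\<Sum>b | adj a b. delta b x) = (if adj a x then 1 else 0)"
  "(\<Sum>b | adj a b. delta x b) = (if adj a x then 1 else 0)"
  using finite_nbrs[of a] by (simp_all add: delta_def eq_commute[of x])

text \<open>On \<open>insert a \<Lambda>\<close> the vector \<open>resp d \<Lambda> a\<close> is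
  mapped to \<open>schur d \<Lambda> a\<close> times \<open>delta a\<close>, so a multiple of it
  repairs the old solution at \<open>a\<close>. The coefficient sums over the first argument of
  \<open>fgreen\<close>; it becomes \<open>resp d \<Lambda> a y\<close> once symmetry is
  available.\<close>

lemma fgreen_step:
  assumes fin: "finite \<Lambda>" and a: "a \<notin> \<Lambda>"
    and d: "\<And>x. x \<in> insert a \<Lambda> \<Longrightarrow> Im (d x) = e" "e \<noteq> 0"
    and sol: "\<And>y. fv_sol d \<Lambda> (delta y) (\<lambda>x. fgreen d \<Lambda> x y)"
  shows "schur d \<Lambda> a \<noteq> 0"
    and "fv_sol d (insert a \<Lambda>) (delta y)
      (\<lambda>x. fgreen d \<Lambda> x y
        + resp d \<Lambda> a x * ((delta a y + (\<Sum>b | adj a b. fgreen d \<Lambda> b y)) / schur d \<Lambda> a))"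
proof -
  let ?g = "fgreen d \<Lambda>"
  have out: "?g x y = 0" if "x \<notin> \<Lambda>" for x y
    using sol[of y] that by (auto simp: fv_sol_def)
  have ing: "hop d (\<lambda>x. ?g x y) x = delta y x" if "x \<in> \<Lambda>" for x y
    using sol[of y] that by (auto simp: fv_sol_def)
  have resp_alt: "resp d \<Lambda> a = (\<lambda>x. delta a x + (\<Sum>b | adj a b. ?g x b))"
    by (simp add: resp_def fun_eq_iff)
  have hop_resp: "hop d (resp d \<Lambda> a) x = (if x = a then schur d \<Lambda> a else 0)"
    if "x \<in> insert a \<Lambda>" for x
  proof (cases "x = a")
    case True
    have "resp d \<Lambda> a a = 1"
      using a by (simp add: resp_def delta_def out)
    moreover have "(\<Sum>y | adj a y. resp d \<Lambda> a y) = (\<Sum>b | adj a b. \<Sum>c | adj a c. ?g b c)"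
      unfolding resp_def using adj_irrefl[of a]
      by (intro sum.cong refl) (auto simp: delta_def)
    ultimately show ?thesis
      using True by (simp add: hop_def schur_def)
  next
    case False
    then have x: "x \<in> \<Lambda>" using that by simp
    have "hop d (\<lambda>x. \<Sum>b | adj a b. ?g x b) x = (\<Sum>b | adj a b. delta b x)"
      by (simp add: hop_sum finite_nbrs ing x)
    moreover have "hop d (delta a) x = - (if adj x a then 1 else 0)"
      using False sum_delta_nbrs(2)[where a = x and x = a] by (simp add: hop_def) (simp add: delta_def)
    ultimately show ?thesis
      unfolding resp_alt using False by (simp add: hop_add sum_delta_nbrs adj_commute[of x a])
  qed
  have resp_out: "resp d \<Lambda> a x = 0" if "x \<notin> insert a \<Lambda>" for x
    using that by (simp add: resp_def delta_def out)
  \<comment> \<open>If the scalar vanished, \<open>resp d \<Lambda> a\<close> would solve the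
    homogeneous problem although its value at \<open>a\<close> is 1.\<close>
  show nz: "schur d \<Lambda> a \<noteq> 0"
  proof
    assume "schur d \<Lambda> a = 0"
    then have "fv_sol d (insert a \<Lambda>) (\<lambda>_. 0) (resp d \<Lambda> a)"
      using hop_resp resp_out by (auto simp: fv_sol_def)
    moreover have "fv_sol d (insert a \<Lambda>) (\<lambda>_. 0) (\<lambda>_. 0)"
      by (simp add: fv_sol_def hop_def)
    ultimately have "resp d \<Lambda> a = (\<lambda>_. 0)"
      by (rule fv_sol_unique[rotated 3]) (use fin d in auto)
    moreover have "resp d \<Lambda> a a = 1"
      using a by (simp add: resp_def delta_def out)
    ultimately show False by simp
  qed
  let ?c = "(delta a y + (\<Sum>b | adj a b. ?g b y)) / schur d \<Lambda> a"
  have "hop d (\<lambda>x. ?g x y + resp d \<Lambda> a x * ?c) x = delta y x" if "x \<in> insert a \<Lambda>" for x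
  proof (cases "x = a")
    case True
    have "hop d (\<lambda>x. ?g x y) a = - (\<Sum>b | adj a b. ?g b y)"
      using a by (simp add: hop_def out)
    then show ?thesis
      using True nz hop_resp[of a]
      by (simp add: hop_add hop_scale del: times_divide_eq_right) (simp add: delta_def)
  next
    case False
    with that show ?thesis
      by (simp add: hop_add hop_scale hop_resp ing del: times_divide_eq_right)
  qed
  then show "fv_sol d (insert a \<Lambda>) (delta y) (\<lambda>x. ?g x y + resp d \<Lambda> a x * ?c)"
    using out resp_out by (auto simp: fv_sol_def)
qed

text \<open>Existence is built up vertex by vertex from the zero function on the empty set;
  uniqueness identifies each updated solution with \<open>fgreen\<close>.\<close>

lemma fv_sol_fgreen:
  assumes "finite \<Lambda>" "\<And>x. x \<in> \<Lambda> \<Longrightarrow> Im (d x) = e" "e \<noteq> 0"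
  shows "fv_sol d \<Lambda> (delta y) (\<lambda>x. fgreen d \<Lambda> x y)"
  using assms(1,2)
proof (induction arbitrary: y)
  case empty
  show ?case by (simp add: fgreen_empty fv_sol_empty)
next
  case (insert a \<Lambda>)
  have "fv_sol d \<Lambda> (delta y) (\<lambda>x. fgreen d \<Lambda> x y)" for y
    using insert by simp
  note sol = fgreen_step(2)[OF insert(1,2,4) assms(3) this, of y]
  have "(\<lambda>x. fgreen d (insert a \<Lambda>) x y) = (\<lambda>x. fgreen d \<Lambda> x y
        + resp d \<Lambda> a x * ((delta a y + (\<Sum>b | adj a b. fgreen d \<Lambda> b y)) / schur d \<Lambda> a))"
    by (rule ext, rule fv_sol_fgreen_if[OF _ insert(4) assms(3) sol]) (use insert in auto)
  then show ?case using sol by simp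
qed

lemma schur_nonzero:
  assumes "finite \<Lambda>" "a \<notin> \<Lambda>" "\<And>x. x \<in> insert a \<Lambda> \<Longrightarrow> Im (d x) = e" "e \<noteq> 0"
  shows "schur d \<Lambda> a \<noteq> 0"
  by (rule fgreen_step(1)[OF assms]) (use assms in \<open>auto intro!: fv_sol_fgreen\<close>)

lemma fgreen_outside:
  assumes "finite \<Lambda>" "\<And>x. x \<in> \<Lambda> \<Longrightarrow> Im (d x) = e" "e \<noteq> 0" "x \<notin> \<Lambda>"
  shows "fgreen d \<Lambda> x y = 0"
  using fv_sol_fgreen[OF assms(1-3)] assms(4) by (auto simp: fv_sol_def)

text \<open>The induction hypothesis turns the coefficient of the update into
  \<open>resp d \<Lambda> a y\<close>, which makes the correction symmetric in \<open>x\<close> and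
  \<open>y\<close>.\<close>

lemma fgreen_sym:
  assumes "finite \<Lambda>" "\<And>x. x \<in> \<Lambda> \<Longrightarrow> Im (d x) = e" "e \<noteq> 0"
  shows "fgreen d \<Lambda> x y = fgreen d \<Lambda> y x"
  using assms(1,2)
proof (induction arbitrary: x y)
  case empty
  show ?case by (simp add: fgreen_empty)
next
  case (insert a \<Lambda>)
  have sol: "fv_sol d \<Lambda> (delta y) (\<lambda>x. fgreen d \<Lambda> x y)" for y
    using insert assms(3) by (auto intro!: fv_sol_fgreen)
  have "fgreen d (insert a \<Lambda>) x y = fgreen d \<Lambda> x y
        + resp d \<Lambda> a x * ((delta a y + (\<Sum>b | adj a b. fgreen d \<Lambda> b y)) / schur d \<Lambda> a)" for x y
    by (rule fv_sol_fgreen_if[OF _ insert(4) assms(3) fgreen_step(2)[OF insert(1,2,4) assms(3) sol]])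
      (use insert in auto)
  moreover have IH: "fgreen d \<Lambda> x y = fgreen d \<Lambda> y x" for x y
    using insert by simp
  then have "delta a y + (\<Sum>b | adj a b. fgreen d \<Lambda> b y) = resp d \<Lambda> a y" for y
    unfolding resp_def by simp
  ultimately show ?case using IH[of x y] by simp
qed

lemma fgreen_insert:
  assumes "finite \<Lambda>" "a \<notin> \<Lambda>" "\<And>x. x \<in> insert a \<Lambda> \<Longrightarrow> Im (d x) = e" "e \<noteq> 0"
  shows "fgreen d (insert a \<Lambda>) x y
    = fgreen d \<Lambda> x y + resp d \<Lambda> a x * resp d \<Lambda> a y / schur d \<Lambda> a"
proof -
  have sol: "fv_sol d \<Lambda> (delta y) (\<lambda>x. fgreen d \<Lambda> x y)" for y
    using assms by (auto intro!: fv_sol_fgreen)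
  have "fgreen d (insert a \<Lambda>) x y = fgreen d \<Lambda> x y
        + resp d \<Lambda> a x * ((delta a y + (\<Sum>b | adj a b. fgreen d \<Lambda> b y)) / schur d \<Lambda> a)"
    by (rule fv_sol_fgreen_if[OF _ assms(3,4) fgreen_step(2)[OF assms sol]])
      (use assms in auto)
  moreover have "fgreen d \<Lambda> x y = fgreen d \<Lambda> y x" for x y
    using assms by (intro fgreen_sym) auto
  then have "delta a y + (\<Sum>b | adj a b. fgreen d \<Lambda> b y) = resp d \<Lambda> a y"
    unfolding resp_def by simp
  ultimately show ?thesis by simp
qed

text \<open>In the row of the new vertex the old Green function vanishes and
  \<open>resp d \<Lambda> a a = 1\<close>, so a single quotient remains.\<close>

lemma fgreen_insert_row:
  assumes "finite \<Lambda>" "a \<notin> \<Lambda>" "\<And>x. x \<in> insert a \<Lambda> \<Longrightarrow> Im (d x) = e" "e \<noteq> 0"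
  shows "fgreen d (insert a \<Lambda>) a y = resp d \<Lambda> a y / schur d \<Lambda> a"
proof -
  have "fgreen d \<Lambda> a c = 0" for c
    by (rule fgreen_outside) (use assms in auto)
  then have "fgreen d \<Lambda> a y = 0" "resp d \<Lambda> a a = 1"
    by (simp_all add: resp_def delta_def)
  then show ?thesis
    using fgreen_insert[OF assms, where x = a and y = y] by simp
qed

lemma fv_sol_exists:
  assumes "finite \<Lambda>" "\<And>x. x \<in> \<Lambda> \<Longrightarrow> Im (d x) = e" "e \<noteq> 0"
  shows "fv_sol d \<Lambda> f (\<lambda>x. \<Sum>y\<in>\<Lambda>. fgreen d \<Lambda> x y * f y)"
proof -
  note sol = fv_sol_fgreen[OF assms]
  have "hop d (\<lambda>x. \<Sum>y\<in>\<Lambda>. fgreen d \<Lambda> x y * f y) x = f x" if "x \<in> \<Lambda>" for x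
  proof -
    have "hop d (\<lambda>x. \<Sum>y\<in>\<Lambda>. fgreen d \<Lambda> x y * f y) x = (\<Sum>y\<in>\<Lambda>. delta y x * f y)"
      using that sol by (simp add: hop_sum hop_scale assms fv_sol_def)
    also have "\<dots> = f x"
      using that assms(1) by (simp add: delta_def if_distrib[of "\<lambda>c. c * _"] cong: if_cong)
    finally show ?thesis .
  qed
  then show ?thesis
    using sol by (simp add: fv_sol_def)
qed

text \<open>Along \<open>fgreen_insert\<close> the entries arise from the values of \<open>d\<close>
  by finitely many sums, products and quotients.\<close>

lemma measurable_fgreen:
  assumes "finite \<Lambda>" "\<And>x a. x \<in> \<Lambda> \<Longrightarrow> Im (d a x) = e" "e \<noteq> 0"
    and "\<And>x. x \<in> \<Lambda> \<Longrightarrow> (\<lambda>a. d a x) \<in> borel_measurable M"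
  shows "(\<lambda>a. fgreen (d a) \<Lambda> x y) \<in> borel_measurable M"
  using assms(1,2,4)
proof (induction arbitrary: x y)
  case empty
  show ?case by (simp add: fgreen_empty)
next
  case (insert b \<Lambda>)
  have [measurable]: "(\<lambda>a. fgreen (d a) \<Lambda> x y) \<in> borel_measurable M" for x y
    using insert by simp
  have [measurable]: "(\<lambda>a. d a b) \<in> borel_measurable M"
    using insert by simp
  show ?case
    by (subst fgreen_insert[OF insert(1,2,4) assms(3)], assumption)
      (unfold resp_def schur_def, measurable)
qed

end

section \<open>Fractional moments of one and two site resolvents\<close>

text \<open>The integrand vanishes outside [-\<kappa>, \<kappa>]. On the right half the singularity
  is integrable because s < 1, and the left half follows by reflection.\<close>

lemma nn_integral_powr_excess:
  fixes \<kappa> s :: real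
  assumes "0 < \<kappa>" "0 < s" "s < 1"
  shows "(\<integral>\<^sup>+x. ennreal (max 0 (\<bar>x\<bar> powr (- s) - \<kappa> powr (- s))) \<partial>lborel)
    = ennreal (2 * \<kappa> powr (1 - s) * s / (1 - s))"
proof -
  let ?f = "\<lambda>x::real. max 0 (\<bar>x\<bar> powr (- s) - \<kappa> powr (- s))"
  define J where "J = \<kappa> powr (1 - s) * s / (1 - s)"
  have "((\<lambda>x. x powr (- s) - \<kappa> powr (- s)) has_integral
      (\<kappa> powr (- s + 1) / (- s + 1) - (\<kappa> - 0) *\<^sub>R (\<kappa> powr (- s)))) {0..\<kappa>}"
    using assms has_integral_const_real[of "\<kappa> powr (- s)" 0 \<kappa>]
    by (intro has_integral_diff has_integral_powr_from_0) auto
  also have "\<kappa> powr (- s + 1) / (- s + 1) - (\<kappa> - 0) *\<^sub>R (\<kappa> powr (- s)) = J"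
  proof -
    have "\<kappa> * \<kappa> powr (- s) = \<kappa> powr (1 - s)"
      using assms by (simp add: powr_diff powr_minus_divide)
    then show ?thesis
      using assms by (simp add: J_def field_simps)
  qed
  finally have "((\<lambda>x. x powr (- s) - \<kappa> powr (- s)) has_integral J) {0..\<kappa>}" .
  \<comment> \<open>The convention \<open>0 powr (- s) = 0\<close> makes the two integrands differ
    at 0, so this point is treated as a spike.\<close>
  then have right: "(?f has_integral J) {0..\<kappa>}"
  proof (rule has_integral_spike_finite[rotated 2])
    fix x assume "x \<in> {0..\<kappa>} - {0}"
    then have "\<kappa> powr (- s) \<le> x powr (- s)"
      using assms by (intro powr_mono2') auto
    then show "?f x = x powr (- s) - \<kappa> powr (- s)"
      using \<open>x \<in> _\<close> by auto
  qed simp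
  then have left: "(?f has_integral J) {-\<kappa>..0}"
    using has_integral_reflect_real[where f = ?f and i = J and a = 0 and b = \<kappa>] by simp
  have "(?f has_integral (J + J)) {-\<kappa>..\<kappa>}"
    by (rule has_integral_combine[OF _ _ left right]) (use assms in auto)
  then have "(?f has_integral (J + J)) UNIV"
  proof (rule has_integral_on_superset)
    fix x assume "x \<notin> {-\<kappa>..\<kappa>}"
    then have "\<bar>x\<bar> powr (- s) \<le> \<kappa> powr (- s)"
      using assms by (intro powr_mono2') auto
    then show "?f x = 0" by simp
  qed simp
  then have "integral\<^sup>N lborel ?f = J + J"
    by (intro nn_integral_has_integral_lborel) auto
  then show ?thesis by (simp add: J_def mult_ac)
qed

text \<open>With \<open>g t = cmod (l t + w) powr (- s)\<close>, the bound \<open>g \<le> \<kappa> powr (- s) + excess\<close> plays the role of a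
  weak-type estimate: it survives maxima of several such functions at the price of adding
  the excesses only. The value \<open>\<infinity>\<close> at the pole makes it immune to the convention \<open>1 / 0 = 0\<close>.\<close>

definition excess :: "real \<Rightarrow> real \<Rightarrow> real \<Rightarrow> complex \<Rightarrow> real \<Rightarrow> ennreal" where
  "excess s \<kappa> l w t = (if of_real (l * t) + w = 0 then \<infinity>
     else ennreal (max 0 (cmod (of_real (l * t) + w) powr (- s) - \<kappa> powr (- s))))"

lemma measurable_excess [measurable]:
  assumes [measurable]: "w \<in> borel_measurable M" "t \<in> borel_measurable M"
  shows "(\<lambda>x. excess s \<kappa> l (w x) (t x)) \<in> borel_measurable M"
  unfolding excess_def by measurable

lemma powr_le_excess:
  assumes "0 < s" "0 \<le> f" "of_real (l * t) + w \<noteq> 0 \<Longrightarrow> f \<le> 1 / cmod (of_real (l * t) + w)"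
  shows "ennreal (f powr s) \<le> ennreal (\<kappa> powr (- s)) + excess s \<kappa> l w t"
proof (cases "of_real (l * t) + w = 0")
  case False
  let ?c = "cmod (of_real (l * t) + w)"
  have "f powr s \<le> (1 / ?c) powr s"
    using assms False by (intro powr_mono2) auto
  also have "\<dots> = ?c powr (- s)"
    by (simp add: powr_divide powr_minus_divide)
  also have "\<dots> \<le> \<kappa> powr (- s) + max 0 (?c powr (- s) - \<kappa> powr (- s))"
    by simp
  finally have "ennreal (f powr s) \<le> ennreal (\<kappa> powr (- s) + max 0 (?c powr (- s) - \<kappa> powr (- s)))"
    by (rule ennreal_leI)
  then show ?thesis
    using False by (simp add: excess_def)
qed (simp add: excess_def)

section \<open>Averages over one and two sites with a bounded density\<close>

locale bounded_density =
  fixes \<rho> :: "real \<Rightarrow> real" and N lam s :: real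
  assumes meas_density [measurable]: "\<rho> \<in> borel_measurable borel"
    and density_le: "AE t in lborel. \<rho> t \<le> N"
    and N_pos: "0 < N" and lam_pos: "0 < lam" and s_pos: "0 < s" and s_less: "s < 1"
    and prob_space_density: "prob_space (density lborel (\<lambda>t. ennreal (\<rho> t)))"
begin

definition \<nu> :: "real measure" where
  "\<nu> = density lborel (\<lambda>t. ennreal (\<rho> t))"

lemma sets_\<nu> [simp, measurable_cong]: "sets \<nu> = sets borel"
  by (simp add: \<nu>_def)

lemma space_\<nu> [simp]: "space \<nu> = UNIV"
  by (simp add: \<nu>_def)

sublocale \<nu>: prob_space \<nu>
  unfolding \<nu>_def by (rule prob_space_density)

lemma nn_integral_\<nu>_le:
  assumes [measurable]: "f \<in> borel_measurable borel"
  shows "(\<integral>\<^sup>+t. f t \<partial>\<nu>) \<le> ennreal N * (\<integral>\<^sup>+t. f t \<partial>lborel)"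
proof -
  have "(\<integral>\<^sup>+t. f t \<partial>\<nu>) = (\<integral>\<^sup>+t. ennreal (\<rho> t) * f t \<partial>lborel)"
    unfolding \<nu>_def by (intro nn_integral_density) auto
  also have "\<dots> \<le> (\<integral>\<^sup>+t. ennreal N * f t \<partial>lborel)"
    using density_le by (intro nn_integral_mono_AE) (auto intro!: mult_right_mono ennreal_leI)
  also have "\<dots> = ennreal N * (\<integral>\<^sup>+t. f t \<partial>lborel)"
    by (intro nn_integral_cmult) auto
  finally show ?thesis .
qed

text \<open>Replacing the modulus by that of the real part can only increase the excess, apart from
  the single zero of the real part; an affine substitution then costs the factor 1 / l.\<close>

lemma nn_integral_excess_le:
  assumes "0 < \<kappa>" "0 < l"
  shows "(\<integral>\<^sup>+t. excess s \<kappa> l w t \<partial>\<nu>) \<le> ennreal (N / l * (2 * \<kappa> powr (1 - s) * s / (1 - s)))"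
proof -
  let ?h = "\<lambda>x::real. ennreal (max 0 (\<bar>x\<bar> powr (- s) - \<kappa> powr (- s)))"
  have "(\<integral>\<^sup>+t. excess s \<kappa> l w t \<partial>\<nu>) \<le> ennreal N * (\<integral>\<^sup>+t. excess s \<kappa> l w t \<partial>lborel)"
    by (rule nn_integral_\<nu>_le) measurable
  also have "(\<integral>\<^sup>+t. excess s \<kappa> l w t \<partial>lborel) \<le> (\<integral>\<^sup>+t. ?h (Re w + l * t) \<partial>lborel)"
  proof (rule nn_integral_mono_AE)
    have "AE t in lborel. t \<noteq> - Re w / l"
      by (rule AE_lborel_singleton)
    then show "AE t in lborel. excess s \<kappa> l w t \<le> ?h (Re w + l * t)"
    proof eventually_elim
      case (elim t)
      then have nz: "Re w + l * t \<noteq> 0"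
        using assms by (auto simp: field_simps)
      have Re: "Re (of_real (l * t) + w) = Re w + l * t" by simp
      have "\<bar>Re w + l * t\<bar> \<le> cmod (of_real (l * t) + w)"
        using abs_Re_le_cmod[of "of_real (l * t) + w"] unfolding Re .
      then have "cmod (of_real (l * t) + w) powr (- s) \<le> \<bar>Re w + l * t\<bar> powr (- s)"
        using nz s_pos by (intro powr_mono2') auto
      moreover have "of_real (l * t) + w \<noteq> 0"
        using nz Re by (metis zero_complex.sel(1))
      ultimately show ?case
        unfolding excess_def by (auto intro!: ennreal_leI)
    qed
  qed
  also have "(\<integral>\<^sup>+t. ?h (Re w + l * t) \<partial>lborel) = ennreal (1 / l) * (\<integral>\<^sup>+t. ?h t \<partial>lborel)"
    by (subst nn_integral_real_affine[where c = "1 / l" and t = "- Re w / l"])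
      (use assms in \<open>auto simp: field_simps\<close>)
  also have "\<dots> = ennreal (1 / l * (2 * \<kappa> powr (1 - s) * s / (1 - s)))"
    using assms by (subst nn_integral_powr_excess[OF _ s_pos s_less]) (simp_all flip: ennreal_mult')
  also have "ennreal N * \<dots> = ennreal (N / l * (2 * \<kappa> powr (1 - s) * s / (1 - s)))"
    using N_pos by (simp flip: ennreal_mult')
  finally show ?thesis by (simp add: mult_left_mono)
qed

text \<open>\<open>C\<^sub>0\<close> and \<open>C\<^sub>1\<close> are the constants C and C' of the
  final bound, with \<open>N\<close> in the role of the essential supremum of the density.\<close>

definition C\<^sub>0 :: real where
  "C\<^sub>0 = lam powr (- s) * N powr s * (2 powr s * s powr (- s) / (1 - s))"

definition C\<^sub>1 :: real where
  "C\<^sub>1 = 2 powr (s + 1) * C\<^sub>0"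

lemma C\<^sub>0_nonneg: "0 \<le> C\<^sub>0" and C\<^sub>0_le_C\<^sub>1: "C\<^sub>0 \<le> C\<^sub>1" and C\<^sub>1_nonneg: "0 \<le> C\<^sub>1"
proof -
  show 1: "0 \<le> C\<^sub>0"
    using s_less by (simp add: C\<^sub>0_def)
  moreover have "1 \<le> 2 powr (s + 1)"
    using s_pos by (intro ge_one_powr_ge_zero) auto
  ultimately show "C\<^sub>0 \<le> C\<^sub>1"
    using mult_right_mono[of 1 "2 powr (s + 1)" C\<^sub>0] by (simp add: C\<^sub>1_def)
  with 1 show "0 \<le> C\<^sub>1" by linarith
qed

lemma one_le_s_powr: "1 \<le> s powr (- s)"
  using s_pos s_less powr_mono2'[of "- s" s 1] by simp

text \<open>The derivative of the left-hand side with respect to the cutoff vanishes at this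
  \<open>\<kappa>\<close>. The weight \<open>m\<close> will be 2 for one site and 8 for two.\<close>

lemma optimal_cutoff:
  assumes "0 < m"
  defines "\<kappa> \<equiv> lam / (m * N)"
  shows "\<kappa> powr (- s) + m * (N / lam * (\<kappa> powr (1 - s) * s / (1 - s)))
    = m powr s * (lam powr (- s) * N powr s / (1 - s))"
proof -
  have \<kappa>: "0 < \<kappa>" using assms N_pos lam_pos by simp
  have "\<kappa> powr (1 - s) = \<kappa> * \<kappa> powr (- s)"
    using \<kappa> by (simp add: powr_diff powr_minus_divide)
  moreover have "m * (N / lam) * \<kappa> = 1"
    using assms N_pos lam_pos by (simp add: \<kappa>_def)
  moreover have "m * (N / lam * (\<kappa> * c * s / (1 - s))) = m * (N / lam) * \<kappa> * (c * s / (1 - s))" for c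
    by simp
  ultimately have "m * (N / lam * (\<kappa> powr (1 - s) * s / (1 - s))) = \<kappa> powr (- s) * s / (1 - s)"
    by (metis mult_1)
  moreover have "\<kappa> powr (- s) + \<kappa> powr (- s) * s / (1 - s) = \<kappa> powr (- s) / (1 - s)"
    using s_less by (simp add: field_simps)
  moreover have "\<kappa> powr (- s) = m powr s * (lam powr (- s) * N powr s)"
    using assms N_pos lam_pos
    by (simp add: \<kappa>_def powr_divide powr_mult powr_minus field_simps)
  ultimately show ?thesis by simp
qed

text \<open>Cutting off at the level that is optimal for weight 2 gives \<open>C\<^sub>0\<close>
  without \<open>s powr (- s)\<close>, a factor that is at least 1.\<close>

lemma one_site_bound:
  "(\<integral>\<^sup>+t. ennreal ((1 / cmod (of_real (lam * t) + w)) powr s) \<partial>\<nu>) \<le> ennreal C\<^sub>0"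
proof -
  define \<kappa> where "\<kappa> = lam / (2 * N)"
  have \<kappa>: "0 < \<kappa>" using N_pos lam_pos by (simp add: \<kappa>_def)
  have "(\<integral>\<^sup>+t. ennreal ((1 / cmod (of_real (lam * t) + w)) powr s) \<partial>\<nu>)
      \<le> (\<integral>\<^sup>+t. ennreal (\<kappa> powr (- s)) + excess s \<kappa> lam w t \<partial>\<nu>)"
    using s_pos by (intro nn_integral_mono powr_le_excess) auto
  also have "\<dots> = ennreal (\<kappa> powr (- s)) + (\<integral>\<^sup>+t. excess s \<kappa> lam w t \<partial>\<nu>)"
    by (subst nn_integral_add) (auto simp: \<nu>.emeasure_space_1[simplified])
  also have "\<dots> \<le> ennreal (\<kappa> powr (- s)) + ennreal (N / lam * (2 * \<kappa> powr (1 - s) * s / (1 - s)))"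
    using \<kappa> lam_pos by (intro add_left_mono nn_integral_excess_le)
  also have "\<dots> = ennreal (2 powr s * (lam powr (- s) * N powr s / (1 - s)))"
    using optimal_cutoff[of 2] \<kappa> s_less s_pos lam_pos N_pos
    by (subst ennreal_plus[symmetric]) (auto simp: \<kappa>_def mult_ac)
  also have "\<dots> \<le> ennreal C\<^sub>0"
    using one_le_s_powr s_less
      mult_left_mono[OF one_le_s_powr, of "2 powr s * (lam powr (- s) * N powr s / (1 - s))"]
    by (intro ennreal_leI) (simp add: C\<^sub>0_def mult_ac)
  finally show ?thesis .
qed

text \<open>The three terms correspond to the regions \<open>|b| \<le> |\<beta>|\<close>, \<open>|b| / 2 \<le> |\<alpha>|\<close> and their common complement,
  where \<open>|\<alpha> \<beta>| \<le> |b|\<^sup>2 / 2\<close> bounds the quotient by \<open>2 / |b|\<close>, which is less than \<open>1 / |\<alpha>|\<close>. Each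
  region is integrated over a single variable, with no restriction on the complex numbers \<open>b\<close>, \<open>p\<close>, \<open>q\<close>.\<close>

lemma offdiag_le_excess:
  fixes b p q :: complex and r t :: real
  defines "\<alpha> \<equiv> of_real (lam * r) + p" and "\<beta> \<equiv> of_real (lam * t) + q"
  shows "ennreal (cmod (b / (\<alpha> * \<beta> - b\<^sup>2)) powr s) \<le> ennreal (\<kappa> powr (- s))
    + (excess s \<kappa> lam (p - b\<^sup>2 / \<beta>) r + (excess s \<kappa> (lam / 2) ((q - b\<^sup>2 / \<alpha>) / 2) t
      + excess s \<kappa> lam p r))" (is "?f \<le> ?K + (?e1 + (?e2 + ?e3))")
proof (cases "b = 0")
  case b: False
  let ?F = "cmod (b / (\<alpha> * \<beta> - b\<^sup>2))"
  consider "cmod b \<le> cmod \<beta>" | "cmod b / 2 \<le> cmod \<alpha>"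
    | "cmod \<beta> < cmod b" "cmod \<alpha> < cmod b / 2" by linarith
  then show ?thesis
  proof cases
    case 1
    then have \<beta>: "\<beta> \<noteq> 0" using b by auto
    have w: "of_real (lam * r) + (p - b\<^sup>2 / \<beta>) = (\<alpha> * \<beta> - b\<^sup>2) / \<beta>"
      using \<beta> by (simp add: \<alpha>_def field_simps)
    have "?F \<le> 1 / cmod (of_real (lam * r) + (p - b\<^sup>2 / \<beta>))"
      unfolding w using 1 by (simp add: norm_divide divide_right_mono)
    then have "?f \<le> ?K + ?e1"
      using s_pos by (intro powr_le_excess) auto
    also have "\<dots> \<le> ?K + (?e1 + (?e2 + ?e3))"
      by (intro add_left_mono) simp
    finally show ?thesis .
  next
    case 2
    then have \<alpha>: "\<alpha> \<noteq> 0" using b by auto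
    have w: "of_real (lam / 2 * t) + (q - b\<^sup>2 / \<alpha>) / 2 = (\<alpha> * \<beta> - b\<^sup>2) / (2 * \<alpha>)"
      using \<alpha> by (simp add: \<beta>_def field_simps)
    have "?F \<le> 1 / cmod (of_real (lam / 2 * t) + (q - b\<^sup>2 / \<alpha>) / 2)"
      unfolding w using 2 by (simp add: norm_divide norm_mult divide_right_mono)
    then have "?f \<le> ?K + ?e2"
      using s_pos by (intro powr_le_excess) auto
    also have "\<dots> \<le> ?K + (?e1 + (?e2 + ?e3))"
      by (intro add_left_mono) (simp add: add_increasing add_increasing2)
    finally show ?thesis .
  next
    case 3
    have "cmod \<alpha> * cmod \<beta> \<le> (cmod b / 2) * cmod b"
      using 3 by (intro mult_mono) auto
    then have "cmod (\<alpha> * \<beta>) \<le> (cmod b)\<^sup>2 / 2"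
      by (simp add: norm_mult power2_eq_square)
    moreover have "cmod (b\<^sup>2) - cmod (\<alpha> * \<beta>) \<le> cmod (\<alpha> * \<beta> - b\<^sup>2)"
      by (metis norm_triangle_ineq2 norm_minus_commute)
    ultimately have lower: "(cmod b)\<^sup>2 / 2 \<le> cmod (\<alpha> * \<beta> - b\<^sup>2)"
      by (simp add: norm_power)
    have pos: "0 < (cmod b)\<^sup>2 / 2" using b by simp
    have "?F \<le> cmod b / ((cmod b)\<^sup>2 / 2)"
      unfolding norm_divide
      by (intro divide_left_mono mult_pos_pos norm_ge_zero pos lower less_le_trans[OF pos lower])
    also have "\<dots> = 2 / cmod b"
      using b by (simp add: power2_eq_square)
    finally have F: "?F \<le> 2 / cmod b" .
    have "?F \<le> 1 / cmod \<alpha>" if "\<alpha> \<noteq> 0"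
    proof -
      have "2 / cmod b \<le> 1 / cmod \<alpha>"
        using 3 b that by (simp add: field_simps)
      with F show ?thesis by linarith
    qed
    then have "?f \<le> ?K + ?e3"
      unfolding \<alpha>_def using s_pos by (intro powr_le_excess) auto
    also have "\<dots> \<le> ?K + (?e1 + (?e2 + ?e3))"
      by (intro add_left_mono) (simp add: add_increasing add_increasing2)
    finally show ?thesis .
  qed
qed simp

lemma two_site_bound:
  "(\<integral>\<^sup>+t. \<integral>\<^sup>+r. ennreal (cmod (b / ((of_real (lam * r) + p) * (of_real (lam * t) + q) - b\<^sup>2)) powr s) \<partial>\<nu> \<partial>\<nu>)
    \<le> ennreal C\<^sub>1"
proof -
  \<comment> \<open>The optimal cutoff for weight 8 = 2 + 4 + 2, the weights of \<open>e1\<close>,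
    \<open>e2\<close> and \<open>e3\<close>; that of \<open>e2\<close> is doubled by its slope
    \<open>lam / 2\<close>.\<close>
  define \<kappa> where "\<kappa> = lam / (8 * N)"
  have \<kappa>: "0 < \<kappa>" using N_pos lam_pos by (simp add: \<kappa>_def)
  interpret pair_sigma_finite \<nu> \<nu> ..
  define E where "E = N / lam * (2 * \<kappa> powr (1 - s) * s / (1 - s))"
  have E: "0 \<le> E" using N_pos lam_pos s_pos s_less by (simp add: E_def)
  define e1 where "e1 t r = excess s \<kappa> lam (p - b\<^sup>2 / (of_real (lam * t) + q)) r" for t r
  define e2 where "e2 t r = excess s \<kappa> (lam / 2) ((q - b\<^sup>2 / (of_real (lam * r) + p)) / 2) t" for t r
  define e3 where "e3 r = excess s \<kappa> lam p r" for r
  have [measurable]: "case_prod e1 \<in> borel_measurable (\<nu> \<Otimes>\<^sub>M \<nu>)"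
    "case_prod e2 \<in> borel_measurable (\<nu> \<Otimes>\<^sub>M \<nu>)" "e3 \<in> borel_measurable \<nu>"
    unfolding e1_def e2_def e3_def by measurable
  have one [simp]: "emeasure \<nu> UNIV = 1"
    using \<nu>.emeasure_space_1 by simp
  have I1: "(\<integral>\<^sup>+r. e1 t r \<partial>\<nu>) \<le> ennreal E" for t
    unfolding e1_def E_def by (intro nn_integral_excess_le \<kappa> lam_pos)
  have I2: "(\<integral>\<^sup>+t. e2 t r \<partial>\<nu>) \<le> ennreal (2 * E)" for r
    using nn_integral_excess_le[OF \<kappa>, of "lam / 2" "(q - b\<^sup>2 / (of_real (lam * r) + p)) / 2"] lam_pos
    by (simp add: e2_def E_def mult_ac)
  have I3: "(\<integral>\<^sup>+r. e3 r \<partial>\<nu>) \<le> ennreal E"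
    unfolding e3_def E_def by (intro nn_integral_excess_le \<kappa> lam_pos)
  have "(\<integral>\<^sup>+t. \<integral>\<^sup>+r. ennreal (cmod (b / ((of_real (lam * r) + p) * (of_real (lam * t) + q) - b\<^sup>2)) powr s) \<partial>\<nu> \<partial>\<nu>)
    \<le> (\<integral>\<^sup>+t. \<integral>\<^sup>+r. ennreal (\<kappa> powr (- s)) + (e1 t r + (e2 t r + e3 r)) \<partial>\<nu> \<partial>\<nu>)"
    unfolding e1_def e2_def e3_def by (intro nn_integral_mono offdiag_le_excess)
  also have "\<dots> = ennreal (\<kappa> powr (- s)) + ((\<integral>\<^sup>+t. \<integral>\<^sup>+r. e1 t r \<partial>\<nu> \<partial>\<nu>)
      + ((\<integral>\<^sup>+t. \<integral>\<^sup>+r. e2 t r \<partial>\<nu> \<partial>\<nu>) + (\<integral>\<^sup>+r. e3 r \<partial>\<nu>)))"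
    by (simp add: nn_integral_add)
  also have "(\<integral>\<^sup>+t. \<integral>\<^sup>+r. e1 t r \<partial>\<nu> \<partial>\<nu>) \<le> (\<integral>\<^sup>+t. ennreal E \<partial>\<nu>)"
    by (intro nn_integral_mono I1)
  \<comment> \<open>The bound for \<open>e2\<close> integrates over \<open>t\<close> with
    \<open>r\<close> frozen, so the order of integration is exchanged.\<close>
  also have "(\<integral>\<^sup>+t. \<integral>\<^sup>+r. e2 t r \<partial>\<nu> \<partial>\<nu>) = (\<integral>\<^sup>+r. \<integral>\<^sup>+t. e2 t r \<partial>\<nu> \<partial>\<nu>)"
    by (rule Fubini') measurable
  also have "\<dots> \<le> (\<integral>\<^sup>+t. ennreal (2 * E) \<partial>\<nu>)"
    by (intro nn_integral_mono I2)
  also note I3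
  also have "ennreal (\<kappa> powr (- s)) + ((\<integral>\<^sup>+t. ennreal E \<partial>\<nu>) + ((\<integral>\<^sup>+t. ennreal (2 * E) \<partial>\<nu>) + ennreal E))
      = ennreal (\<kappa> powr (- s) + 4 * E)"
    using E by (simp flip: ennreal_plus)
  also have "\<kappa> powr (- s) + 4 * E = 8 powr s * (lam powr (- s) * N powr s / (1 - s))"
    using optimal_cutoff[of 8] by (simp add: E_def \<kappa>_def mult_ac)
  also have "\<dots> \<le> C\<^sub>1"
  proof -
    \<comment> \<open>The exponent 3 s is at most 1 + 2 s; this produces the prefactor
      \<open>2 powr (s + 1)\<close> of \<open>C\<^sub>1\<close>.\<close>
    have "8 powr s = 2 powr s * (2 powr s * (2 powr s :: real))"
      by (simp flip: powr_mult)
    also have "\<dots> \<le> 2 powr 1 * (2 powr s * (2 powr s :: real))"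
      using s_less by (intro mult_right_mono powr_mono) auto
    also have "\<dots> = 2 powr (s + 1) * 2 powr s * 1"
      by (simp add: powr_add)
    also have "\<dots> \<le> 2 powr (s + 1) * 2 powr s * s powr (- s)"
      by (intro mult_left_mono one_le_s_powr) simp
    finally have "8 powr s * (lam powr (- s) * N powr s / (1 - s))
      \<le> (2 powr (s + 1) * 2 powr s * s powr (- s)) * (lam powr (- s) * N powr s / (1 - s))"
      using s_less by (intro mult_right_mono) auto
    then show ?thesis
      by (simp add: C\<^sub>1_def C\<^sub>0_def mult_ac)
  qed
  finally show ?thesis
    by (simp add: add_left_mono add_right_mono add_mono ennreal_leI)
qed

end

section \<open>Fractional moments in finite volume\<close>

text \<open>On [0, 1] one has t \<le> \<open>t powr s\<close>; this is applied to the fractions a /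
  (a + b) and b / (a + b), whose sum is 1.\<close>

lemma powr_add_le:
  fixes a b s :: real
  assumes "0 \<le> a" "0 \<le> b" "0 < s" "s \<le> 1"
  shows "(a + b) powr s \<le> a powr s + b powr s"
proof (cases "a + b = 0")
  case False
  then have ab: "0 < a + b" using assms by simp
  have le: "t \<le> t powr s" if "0 \<le> t" "t \<le> 1" for t :: real
    using that assms powr_mono'[of s 1 t] by simp
  have "(a + b) powr s * 1 = (a + b) powr s * (a / (a + b) + b / (a + b))"
    using ab by (simp add: add_divide_distrib[symmetric])
  also have "\<dots> \<le> (a + b) powr s * ((a / (a + b)) powr s + (b / (a + b)) powr s)"
    using ab assms by (intro mult_left_mono add_mono le) auto
  also have "\<dots> = a powr s + b powr s"
    using ab assms by (simp add: powr_divide distrib_left)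
  finally show ?thesis by simp
qed (use assms in auto)

lemma norm_sum_powr_le:
  assumes "finite I" "0 < s" "s \<le> 1"
  shows "norm (\<Sum>i\<in>I. f i) powr s \<le> (\<Sum>i\<in>I. norm (f i) powr s)"
  using assms(1)
proof induction
  case (insert i I)
  have "norm (\<Sum>i\<in>insert i I. f i) powr s \<le> (norm (f i) + norm (\<Sum>i\<in>I. f i)) powr s"
    using insert assms by (auto intro!: powr_mono2 norm_triangle_ineq)
  also have "\<dots> \<le> norm (f i) powr s + norm (\<Sum>i\<in>I. f i) powr s"
    using assms by (intro powr_add_le) auto
  finally show ?case using insert by simp
qed simp

section \<open>Moments of the finite-volume Green function\<close>

locale anderson = lf_graph adj + bounded_density \<rho> N lam s
  for adj :: "'v \<Rightarrow> 'v \<Rightarrow> bool" and \<rho> N lam s +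
  fixes z :: complex
  assumes Im_z: "Im z \<noteq> 0"
begin

text \<open>The diagonal of H - z. Its imaginary part is the constant \<open>- Im z\<close>, as the
  finite-volume theory demands.\<close>

definition pot :: "('v \<Rightarrow> real) \<Rightarrow> 'v \<Rightarrow> complex" where
  "pot v x = of_nat (valence adj x) + of_real (lam * v x) - z"

lemma Im_pot: "Im (pot v x) = - Im z"
  by (simp add: pot_def)

lemma Im_z': "- Im z \<noteq> 0"
  using Im_z by simp

abbreviation PN :: "'v set \<Rightarrow> ('v \<Rightarrow> real) measure" where
  "PN \<Lambda> \<equiv> PiM \<Lambda> (\<lambda>_. \<nu>)"

lemma measurable_fgreen_pot:
  assumes "finite \<Lambda>" "\<Lambda> \<subseteq> \<Lambda>'"
  shows "(\<lambda>v. fgreen (pot v) \<Lambda> x y) \<in> borel_measurable (PN \<Lambda>')"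
proof (rule measurable_fgreen[where d = pot and e = "- Im z", OF assms(1) _ Im_z'])
  show "Im (pot v x) = - Im z" for v x
    by (rule Im_pot)
next
  fix x assume "x \<in> \<Lambda>"
  then have "(\<lambda>v. v x) \<in> PN \<Lambda>' \<rightarrow>\<^sub>M \<nu>"
    using assms by (intro measurable_component_singleton) auto
  then have [measurable]: "(\<lambda>v. v x) \<in> borel_measurable (PN \<Lambda>')"
    by (simp cong: measurable_cong_sets)
  show "(\<lambda>v. pot v x) \<in> borel_measurable (PN \<Lambda>')"
    unfolding pot_def by measurable
qed

sublocale P: product_sigma_finite "\<lambda>_::'v. \<nu>"
  by unfold_locales

lemma emeasure_PN: "emeasure (PN \<Lambda>) (space (PN \<Lambda>)) = 1"
  by (intro prob_space.emeasure_space_1 prob_space_PiM \<nu>.prob_space_axioms)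

definition fmom :: "'v set \<Rightarrow> 'v \<Rightarrow> 'v \<Rightarrow> ennreal" where
  "fmom \<Lambda> x y = (\<integral>\<^sup>+v. ennreal (cmod (fgreen (pot v) \<Lambda> x y) powr s) \<partial>PN \<Lambda>)"

lemma fgreen_pot_sym: "finite \<Lambda> \<Longrightarrow> fgreen (pot v) \<Lambda> x y = fgreen (pot v) \<Lambda> y x"
  by (rule fgreen_sym[OF _ Im_pot Im_z'])

lemma fgreen_pot_outside:
  assumes "finite \<Lambda>" "x \<notin> \<Lambda> \<or> y \<notin> \<Lambda>"
  shows "fgreen (pot v) \<Lambda> x y = 0"
  using assms(2)
proof
  assume "x \<notin> \<Lambda>"
  then show ?thesis by (rule fgreen_outside[OF assms(1) Im_pot Im_z'])
next
  assume "y \<notin> \<Lambda>"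
  then show ?thesis
    by (subst fgreen_pot_sym[OF assms(1)]) (rule fgreen_outside[OF assms(1) Im_pot Im_z'])
qed

text \<open>The potential at \<open>a\<close> enters the rank one update only through the
  denominator, and there only as the term \<open>lam * t\<close>.\<close>

lemma fgreen_pot_upd:
  assumes "a \<notin> \<Lambda>"
  shows "fgreen (pot (v(a := t))) \<Lambda> = fgreen (pot v) \<Lambda>"
    and "resp (pot (v(a := t))) \<Lambda> = resp (pot v) \<Lambda>"
    and "schur (pot (v(a := t))) \<Lambda> a = of_real (lam * t) + (of_nat (valence adj a) - z
      - (\<Sum>b | adj a b. \<Sum>c | adj a c. fgreen (pot v) \<Lambda> b c))"
proof -
  show 1: "fgreen (pot (v(a := t))) \<Lambda> = fgreen (pot v) \<Lambda>"
    using assms by (intro fgreen_cong) (auto simp: pot_def)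
  show "resp (pot (v(a := t))) \<Lambda> = resp (pot v) \<Lambda>"
    by (simp add: resp_def 1 fun_eq_iff)
  show "schur (pot (v(a := t))) \<Lambda> a = of_real (lam * t) + (of_nat (valence adj a) - z
      - (\<Sum>b | adj a b. \<Sum>c | adj a c. fgreen (pot v) \<Lambda> b c))"
    by (simp add: schur_def 1 pot_def)
qed

text \<open>The potential at \<open>a\<close> is integrated first. In row \<open>a\<close> the
  numerator is free of it and the denominator is affine in it, so \<open>one_site_bound\<close>
  applies with all other variables frozen.\<close>

lemma fmom_insert_le:
  assumes "finite \<Lambda>" "a \<notin> \<Lambda>"
  shows "fmom (insert a \<Lambda>) a y
    \<le> ennreal C\<^sub>0 * (\<integral>\<^sup>+v. ennreal (cmod (resp (pot v) \<Lambda> a y) powr s) \<partial>PN \<Lambda>)"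
proof -
  have [measurable]: "(\<lambda>v. fgreen (pot v) \<Lambda> b c) \<in> borel_measurable (PN \<Lambda>)" for b c
    by (rule measurable_fgreen_pot[OF assms(1)]) simp
  have "fmom (insert a \<Lambda>) a y = (\<integral>\<^sup>+v. (\<integral>\<^sup>+t. ennreal (cmod (fgreen (pot (v(a := t))) (insert a \<Lambda>) a y) powr s) \<partial>\<nu>) \<partial>PN \<Lambda>)"
    unfolding fmom_def using assms measurable_fgreen_pot[of "insert a \<Lambda>" "insert a \<Lambda>" a y]
    by (subst P.product_nn_integral_insert) auto
  also have "\<dots> \<le> (\<integral>\<^sup>+v. ennreal (cmod (resp (pot v) \<Lambda> a y) powr s) * ennreal C\<^sub>0 \<partial>PN \<Lambda>)"
  proof (rule nn_integral_mono)
    fix v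
    let ?u = "resp (pot v) \<Lambda> a y"
    let ?w = "of_nat (valence adj a) - z - (\<Sum>b | adj a b. \<Sum>c | adj a c. fgreen (pot v) \<Lambda> b c)"
    have "(\<integral>\<^sup>+t. ennreal (cmod (fgreen (pot (v(a := t))) (insert a \<Lambda>) a y) powr s) \<partial>\<nu>)
      = (\<integral>\<^sup>+t. ennreal (cmod ?u powr s) * ennreal ((1 / cmod (of_real (lam * t) + ?w)) powr s) \<partial>\<nu>)"
    proof (rule nn_integral_cong)
      fix t
      have "fgreen (pot (v(a := t))) (insert a \<Lambda>) a y = ?u / (of_real (lam * t) + ?w)"
        unfolding fgreen_insert_row[OF assms Im_pot Im_z'] fgreen_pot_upd[OF assms(2)] ..
      then have "cmod (fgreen (pot (v(a := t))) (insert a \<Lambda>) a y) = cmod ?u * (1 / cmod (of_real (lam * t) + ?w))"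
        by (simp add: norm_divide)
      then show "ennreal (cmod (fgreen (pot (v(a := t))) (insert a \<Lambda>) a y) powr s)
        = ennreal (cmod ?u powr s) * ennreal ((1 / cmod (of_real (lam * t) + ?w)) powr s)"
        by (simp only: powr_mult) (simp add: ennreal_mult')
    qed
    also have "\<dots> = ennreal (cmod ?u powr s) * (\<integral>\<^sup>+t. ennreal ((1 / cmod (of_real (lam * t) + ?w)) powr s) \<partial>\<nu>)"
      by (intro nn_integral_cmult) measurable
    also have "\<dots> \<le> ennreal (cmod ?u powr s) * ennreal C\<^sub>0"
      by (intro mult_left_mono one_site_bound) simp
    finally show "(\<integral>\<^sup>+t. ennreal (cmod (fgreen (pot (v(a := t))) (insert a \<Lambda>) a y) powr s) \<partial>\<nu>)
      \<le> ennreal (cmod ?u powr s) * ennreal C\<^sub>0" .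
  qed
  also have "\<dots> = ennreal C\<^sub>0 * (\<integral>\<^sup>+v. ennreal (cmod (resp (pot v) \<Lambda> a y) powr s) \<partial>PN \<Lambda>)"
    by (subst nn_integral_multc) (auto simp: mult.commute resp_def)
  finally show ?thesis .
qed

lemma fmom_diag_le:
  assumes "finite \<Lambda>" "a \<notin> \<Lambda>"
  shows "fmom (insert a \<Lambda>) a a \<le> ennreal C\<^sub>0"
proof -
  have "resp (pot v) \<Lambda> a a = 1" for v
    using fgreen_pot_outside[OF assms(1)] assms(2) by (simp add: resp_def delta_def)
  then have "(\<integral>\<^sup>+v. ennreal (cmod (resp (pot v) \<Lambda> a a) powr s) \<partial>PN \<Lambda>) = 1"
    using emeasure_PN by simp
  then show ?thesis
    using fmom_insert_le[OF assms, of a] by simp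
qed

text \<open>For \<open>y \<noteq> a\<close> the \<open>delta\<close> term of \<open>resp\<close>
  vanishes, and s-th powers are subadditive over the neighbours. The moments on the right live on
  the set without \<open>a\<close>, which is what makes the resulting walks self-avoiding.\<close>

lemma fmom_step_le:
  assumes "finite \<Lambda>" "a \<notin> \<Lambda>" "y \<noteq> a"
  shows "fmom (insert a \<Lambda>) a y \<le> ennreal C\<^sub>0 * (\<Sum>b | adj a b. fmom \<Lambda> b y)"
proof -
  have [measurable]: "(\<lambda>v. fgreen (pot v) \<Lambda> b c) \<in> borel_measurable (PN \<Lambda>)" for b c
    by (rule measurable_fgreen_pot[OF assms(1)]) simp
  have "(\<integral>\<^sup>+v. ennreal (cmod (resp (pot v) \<Lambda> a y) powr s) \<partial>PN \<Lambda>)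
    \<le> (\<integral>\<^sup>+v. (\<Sum>b | adj a b. ennreal (cmod (fgreen (pot v) \<Lambda> b y) powr s)) \<partial>PN \<Lambda>)"
  proof (rule nn_integral_mono)
    fix v
    have "resp (pot v) \<Lambda> a y = (\<Sum>b | adj a b. fgreen (pot v) \<Lambda> b y)"
      using assms(3) by (simp add: resp_def delta_def)
        (intro sum.cong refl fgreen_pot_sym assms(1))
    then have "cmod (resp (pot v) \<Lambda> a y) powr s \<le> (\<Sum>b | adj a b. cmod (fgreen (pot v) \<Lambda> b y) powr s)"
      using s_pos s_less by (simp add: norm_sum_powr_le finite_nbrs)
    then show "ennreal (cmod (resp (pot v) \<Lambda> a y) powr s)
      \<le> (\<Sum>b | adj a b. ennreal (cmod (fgreen (pot v) \<Lambda> b y) powr s))"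
      by (subst sum_ennreal) (auto intro: ennreal_leI)
  qed
  also have "\<dots> = (\<Sum>b | adj a b. fmom \<Lambda> b y)"
    unfolding fmom_def by (intro nn_integral_sum) measurable
  finally show ?thesis
    using fmom_insert_le[OF assms(1,2), of y] by (meson mult_left_mono order_trans zero_le)
qed

text \<open>Adding \<open>b\<close> and then \<open>a\<close> amounts to inverting a symmetric 2 by
  2 matrix. The off-diagonal entry of its inverse has the form treated in
  \<open>two_site_bound\<close>, with \<open>p\<close>, \<open>q\<close> and \<open>B\<close>
  depending only on the potential in \<open>\<Lambda>\<close>.\<close>

lemma fmom_offdiag_le:
  assumes fin: "finite \<Lambda>" and ab: "a \<notin> \<Lambda>" "b \<notin> \<Lambda>" "a \<noteq> b"
  shows "fmom (insert a (insert b \<Lambda>)) a b \<le> ennreal C\<^sub>1"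
proof -
  let ?\<Lambda> = "insert b \<Lambda>"
  have fin': "finite ?\<Lambda>" "a \<notin> ?\<Lambda>" using fin ab by auto
  define F where "F v = ennreal (cmod (fgreen (pot v) (insert a ?\<Lambda>) a b) powr s)" for v
  have [measurable]: "F \<in> borel_measurable (PN (insert a ?\<Lambda>))"
    unfolding F_def using measurable_fgreen_pot[of "insert a ?\<Lambda>" "insert a ?\<Lambda>" a b] fin by simp
  have "fmom (insert a ?\<Lambda>) a b = (\<integral>\<^sup>+v. (\<integral>\<^sup>+r. F (v(a := r)) \<partial>\<nu>) \<partial>PN ?\<Lambda>)"
    unfolding fmom_def F_def[symmetric] using fin'
    by (subst P.product_nn_integral_insert) auto
  also have "\<dots> = (\<integral>\<^sup>+v. (\<integral>\<^sup>+t. (\<integral>\<^sup>+r. F (v(b := t, a := r)) \<partial>\<nu>) \<partial>\<nu>) \<partial>PN \<Lambda>)"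
  proof (rule P.product_nn_integral_insert[OF fin ab(2)])
    have "(\<lambda>(v, r). F (v(a := r))) \<in> borel_measurable (PN ?\<Lambda> \<Otimes>\<^sub>M \<nu>)"
      using measurable_comp[OF measurable_add_dim[of a ?\<Lambda> "\<lambda>_. \<nu>"], of F borel]
      by (simp add: comp_def case_prod_unfold)
    then show "(\<lambda>v. \<integral>\<^sup>+r. F (v(a := r)) \<partial>\<nu>) \<in> borel_measurable (PN ?\<Lambda>)"
      by (rule \<nu>.borel_measurable_nn_integral)
  qed
  also have "\<dots> \<le> (\<integral>\<^sup>+v. ennreal C\<^sub>1 \<partial>PN \<Lambda>)"
  proof (rule nn_integral_mono)
    fix v
    define g where "g = fgreen (pot v) \<Lambda>"
    define u where "u = resp (pot v) \<Lambda> b"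
    \<comment> \<open>The effective coupling of \<open>a\<close> and \<open>b\<close>: their edge,
      if there is one, plus the connection through \<open>\<Lambda>\<close>.\<close>
    define B where "B = (\<Sum>c | adj a c. u c)"
    define p where "p = of_nat (valence adj a) - z - (\<Sum>c | adj a c. \<Sum>c' | adj a c'. g c c')"
    define q where "q = of_nat (valence adj b) - z - (\<Sum>c | adj b c. \<Sum>c' | adj b c'. g c c')"
    have "F (v(b := t, a := r))
      = ennreal (cmod (B / ((of_real (lam * r) + p) * (of_real (lam * t) + q) - B\<^sup>2)) powr s)" for t r
    proof -
      define V where "V = pot (v(b := t))"
      define \<alpha> where "\<alpha> = of_real (lam * r) + p"
      define \<beta> where "\<beta> = of_real (lam * t) + q"
      have \<beta>: "schur V \<Lambda> b = \<beta>"
        using fgreen_pot_upd(3)[OF ab(2), of v t] by (simp add: \<beta>_def q_def g_def V_def)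
      have nz: "\<beta> \<noteq> 0"
        unfolding \<beta>[symmetric] V_def by (rule schur_nonzero[OF fin ab(2) Im_pot Im_z'])
      have row: "fgreen V ?\<Lambda> b c = u c / \<beta>" for c
        using fgreen_insert_row[OF fin ab(2) Im_pot Im_z'] \<beta>
        by (simp add: V_def u_def fgreen_pot_upd[OF ab(2)])
      have full: "fgreen V ?\<Lambda> c c' = g c c' + u c * u c' / \<beta>" for c c'
        using fgreen_insert[OF fin ab(2) Im_pot Im_z'] \<beta>
        by (simp add: V_def u_def g_def fgreen_pot_upd[OF ab(2)])
      have resp: "resp V ?\<Lambda> a b = B / \<beta>"
        using ab by (simp add: resp_def delta_def row B_def sum_divide_distrib)
      \<comment> \<open>The rank one term factorises in \<open>c\<close> and \<open>c'\<close>, so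
        its double sum is a square: adding \<open>b\<close> shifts the denominator at
        \<open>a\<close> by \<open>B\<^sup>2 / \<beta>\<close>.\<close>
      have "(\<Sum>c | adj a c. \<Sum>c' | adj a c'. fgreen V ?\<Lambda> c c')
        = (\<Sum>c | adj a c. \<Sum>c' | adj a c'. g c c') + B\<^sup>2 / \<beta>"
        by (simp only: full sum.distrib B_def power2_eq_square sum_product sum_divide_distrib)
      then have "schur (pot (v(b := t, a := r))) ?\<Lambda> a = \<alpha> - B\<^sup>2 / \<beta>"
        using fgreen_pot_upd(3)[OF fin'(2), of "v(b := t)" r] by (simp add: V_def \<alpha>_def p_def)
      then have "fgreen (pot (v(b := t, a := r))) (insert a ?\<Lambda>) a b = (B / \<beta>) / (\<alpha> - B\<^sup>2 / \<beta>)"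
        using fgreen_insert_row[where d = "pot (v(b := t, a := r))" and y = b, OF fin' Im_pot Im_z'] resp
        by (simp add: V_def fgreen_pot_upd(2)[OF fin'(2)])
      also have "\<dots> = B / (\<alpha> * \<beta> - B\<^sup>2)"
      proof -
        have "\<alpha> - B\<^sup>2 / \<beta> = (\<alpha> * \<beta> - B\<^sup>2) / \<beta>"
          using nz by (simp add: field_simps)
        then show ?thesis using nz by simp
      qed
      finally show ?thesis
        by (simp add: F_def \<alpha>_def \<beta>_def)
    qed
    then show "(\<integral>\<^sup>+t. (\<integral>\<^sup>+r. F (v(b := t, a := r)) \<partial>\<nu>) \<partial>\<nu>) \<le> ennreal C\<^sub>1"
      using two_site_bound[of B p q] by simp
  qed
  also have "\<dots> = ennreal C\<^sub>1"
    using emeasure_PN by simp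
  finally show ?thesis .
qed

text \<open>The distinction by \<open>x \<in> \<Lambda>\<close> matches the number of walks of
  length 0 inside \<open>\<Lambda>\<close>, so that the bound can start the walk expansion.\<close>

lemma fmom_le:
  assumes "finite \<Lambda>"
  shows "fmom \<Lambda> x y \<le> (if x \<in> \<Lambda> then ennreal C\<^sub>1 else 0)"
proof -
  consider "x \<notin> \<Lambda> \<or> y \<notin> \<Lambda>" | "x \<in> \<Lambda>" "x = y" | "x \<in> \<Lambda>" "y \<in> \<Lambda>" "x \<noteq> y" by blast
  then show ?thesis
  proof cases
    case 1
    then have "fmom \<Lambda> x y = 0"
      by (simp add: fmom_def fgreen_pot_outside[OF assms])
    then show ?thesis by simp
  next
    case 2
    then have "fmom \<Lambda> x y \<le> ennreal C\<^sub>0"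
      using fmom_diag_le[of "\<Lambda> - {x}" x] assms by (simp add: insert_absorb)
    also have "\<dots> \<le> ennreal C\<^sub>1"
      by (intro ennreal_leI C\<^sub>0_le_C\<^sub>1)
    finally show ?thesis using 2 by simp
  next
    case 3
    then have "insert x (insert y (\<Lambda> - {x, y})) = \<Lambda>" by auto
    then show ?thesis
      using fmom_offdiag_le[of "\<Lambda> - {x, y}" x y] assms 3 by simp
  qed
qed

section \<open>Expansion into self-avoiding walks\<close>

definition saws :: "'v set \<Rightarrow> 'v \<Rightarrow> nat \<Rightarrow> 'v list set" where
  "saws \<Lambda> x n = {xs \<in> walks adj x n. distinct xs \<and> set xs \<subseteq> \<Lambda>}"

lemma finite_saws: "finite \<Lambda> \<Longrightarrow> finite (saws \<Lambda> x n)"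
  by (rule finite_subset[OF _ finite_lists_length_eq[of \<Lambda> "Suc n"]])
    (auto simp: saws_def walks_def)

lemma Cons_walks:
  assumes "adj x b" "xs \<in> walks adj b n"
  shows "x # xs \<in> walks adj x (Suc n)"
  using assms by (auto simp: walks_def successively_Cons)

text \<open>Prepending \<open>x\<close> to a self-avoiding walk in \<open>\<Lambda> - {x}\<close>
  keeps it self-avoiding, and walks with different second vertices are different.\<close>

lemma sum_card_saws_le:
  assumes "finite \<Lambda>" "x \<in> \<Lambda>"
  shows "(\<Sum>b | adj x b. card (saws (\<Lambda> - {x}) b n)) \<le> card (saws \<Lambda> x (Suc n))"
proof -
  have "(\<Sum>b | adj x b. card (saws (\<Lambda> - {x}) b n)) = (\<Sum>b | adj x b. card ((#) x ` saws (\<Lambda> - {x}) b n))"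
    by (intro sum.cong refl card_image[symmetric]) auto
  also have "\<dots> = card (\<Union>b\<in>{b. adj x b}. (#) x ` saws (\<Lambda> - {x}) b n)"
    using assms by (intro card_UN_disjoint[symmetric])
      (auto simp: finite_nbrs finite_saws, auto simp: saws_def walks_def)
  also have "\<dots> \<le> card (saws \<Lambda> x (Suc n))"
  proof (intro card_mono finite_saws assms)
    show "(\<Union>b\<in>{b. adj x b}. (#) x ` saws (\<Lambda> - {x}) b n) \<subseteq> saws \<Lambda> x (Suc n)"
      using assms by (auto simp: saws_def Cons_walks)
  qed
  finally show ?thesis .
qed

text \<open>As long as \<open>y\<close> is out of reach the current vertex differs from
  \<open>y\<close> and \<open>fmom_step_le\<close> applies. After \<open>n\<close> expansions, each
  deleting its vertex, \<open>fmom_le\<close> bounds what is left.\<close>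

lemma fmom_saws_le:
  assumes "finite \<Lambda>" "\<And>k xs. k < n \<Longrightarrow> xs \<in> walks adj x k \<Longrightarrow> last xs \<noteq> y"
  shows "fmom \<Lambda> x y \<le> ennreal (C\<^sub>1 * C\<^sub>0 ^ n * card (saws \<Lambda> x n))"
  using assms
proof (induction n arbitrary: x \<Lambda>)
  case 0
  show ?case
  proof (cases "x \<in> \<Lambda>")
    case True
    have "saws \<Lambda> x 0 = {[x]}"
      using True by (auto simp: saws_def walks_def length_Suc_conv)
    then show ?thesis
      using fmom_le[OF 0(1), of x y] True by simp
  qed (use fmom_le[OF 0(1), of x y] in simp)
next
  case (Suc n)
  show ?case
  proof (cases "x \<in> \<Lambda>")
    case True
    have "[x] \<in> walks adj x 0" by (simp add: walks_def)
    then have "y \<noteq> x" using Suc.prems(2)[of 0 "[x]"] by auto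
    then have "fmom \<Lambda> x y \<le> ennreal C\<^sub>0 * (\<Sum>b | adj x b. fmom (\<Lambda> - {x}) b y)"
      using fmom_step_le[of "\<Lambda> - {x}" x y] Suc.prems(1) True by (simp add: insert_absorb)
    also have "\<dots> \<le> ennreal C\<^sub>0 * (\<Sum>b | adj x b. ennreal (C\<^sub>1 * C\<^sub>0 ^ n * card (saws (\<Lambda> - {x}) b n)))"
    proof (intro mult_left_mono sum_mono)
      fix b assume "b \<in> {b. adj x b}"
      \<comment> \<open>A walk of length \<open>k\<close> from the neighbour \<open>b\<close>
        extends to one of length \<open>Suc k\<close> from \<open>x\<close>, so the hypothesis on
        \<open>y\<close> is inherited with \<open>n\<close> lowered by one.\<close>
      then have "last xs \<noteq> y" if "k < n" "xs \<in> walks adj b k" for k xs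
        using Suc.prems(2)[of "Suc k" "x # xs"] Cons_walks[of x b xs k] that
        by (auto simp: walks_def split: if_splits)
      then show "fmom (\<Lambda> - {x}) b y \<le> ennreal (C\<^sub>1 * C\<^sub>0 ^ n * card (saws (\<Lambda> - {x}) b n))"
        using Suc.prems(1) by (intro Suc.IH) auto
    qed simp
    also have "\<dots> = ennreal (C\<^sub>1 * C\<^sub>0 ^ Suc n * (\<Sum>b | adj x b. card (saws (\<Lambda> - {x}) b n)))"
      using C\<^sub>0_nonneg C\<^sub>1_nonneg
      by (simp add: sum_ennreal ennreal_mult[symmetric] sum_nonneg sum_distrib_left mult_ac)
    also have "\<dots> \<le> ennreal (C\<^sub>1 * C\<^sub>0 ^ Suc n * card (saws \<Lambda> x (Suc n)))"
      using C\<^sub>0_nonneg C\<^sub>1_nonneg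
      by (intro ennreal_leI mult_left_mono of_nat_mono sum_card_saws_le Suc.prems True) auto
    finally show ?thesis .
  qed (use fmom_le[OF Suc.prems(1), of x y] in simp)
qed

end

section \<open>The selfadjoint Laplacian and the infinite volume limit\<close>

lemma ell2_sum_le:
  assumes "\<phi> \<in> ell2" "finite A"
  shows "(\<Sum>x\<in>A. (cmod (\<phi> x))\<^sup>2) \<le> (\<Sum>\<^sub>\<infinity>x. (cmod (\<phi> x))\<^sup>2)"
  using assms by (intro finite_sum_le_infsum) (auto simp: ell2_def)

lemma ell2I:
  assumes "\<And>A. finite A \<Longrightarrow> (\<Sum>x\<in>A. (cmod (\<phi> x))\<^sup>2) \<le> R"
  shows "\<phi> \<in> ell2"
  unfolding ell2_def using assms
  by (auto intro!: nonneg_bounded_partial_sums_imp_summable_on[where C = R] eventually_finite_subsets_at_top_weakI)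

lemma finite_support_ell2:
  assumes "finite {x. \<phi> x \<noteq> 0}"
  shows "\<phi> \<in> ell2"
proof (rule ell2I)
  fix A :: "'a set" assume "finite A"
  then have "(\<Sum>x\<in>A. (cmod (\<phi> x))\<^sup>2) = (\<Sum>x\<in>A \<inter> {x. \<phi> x \<noteq> 0}. (cmod (\<phi> x))\<^sup>2)"
    by (intro sum.mono_neutral_right) auto
  also have "\<dots> \<le> (\<Sum>x | \<phi> x \<noteq> 0. (cmod (\<phi> x))\<^sup>2)"
    using assms by (intro sum_mono2) auto
  finally show "(\<Sum>x\<in>A. (cmod (\<phi> x))\<^sup>2) \<le> (\<Sum>x | \<phi> x \<noteq> 0. (cmod (\<phi> x))\<^sup>2)" .
qed

lemma norm_add_squared_le: "(norm (a + b))\<^sup>2 \<le> 2 * (norm a)\<^sup>2 + 2 * (norm b)\<^sup>2"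
proof -
  have "(norm (a + b))\<^sup>2 \<le> (norm a + norm b)\<^sup>2"
    by (intro power_mono norm_triangle_ineq) simp
  also have "\<dots> \<le> 2 * (norm a)\<^sup>2 + 2 * (norm b)\<^sup>2"
    using zero_le_power2[of "norm a - norm b"] by (simp add: power2_eq_square algebra_simps)
  finally show ?thesis .
qed

lemma ell2_add:
  assumes "\<phi> \<in> ell2" "\<psi> \<in> ell2"
  shows "(\<lambda>x. \<phi> x + \<psi> x) \<in> ell2"
proof -
  have "(\<lambda>x. 2 * (cmod (\<phi> x))\<^sup>2 + 2 * (cmod (\<psi> x))\<^sup>2) summable_on UNIV"
    using assms by (intro summable_on_add summable_on_cmult_right) (auto simp: ell2_def)
  then show ?thesis
    unfolding ell2_def mem_Collect_eq
    by (rule summable_on_comparison_test) (auto intro: norm_add_squared_le)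
qed

lemma ell2_mult_bounded:
  assumes "\<phi> \<in> ell2" "\<And>x. cmod (c x) \<le> K"
  shows "(\<lambda>x. c x * \<phi> x) \<in> ell2"
proof -
  have "(\<lambda>x. K\<^sup>2 * (cmod (\<phi> x))\<^sup>2) summable_on UNIV"
    using assms by (intro summable_on_cmult_right) (auto simp: ell2_def)
  then show ?thesis
    unfolding ell2_def mem_Collect_eq
    by (rule summable_on_comparison_test)
      (auto simp: norm_mult power_mult_distrib intro!: mult_right_mono power_mono assms(2))
qed

lemma ell2_scale: "\<phi> \<in> ell2 \<Longrightarrow> (\<lambda>x. c * \<phi> x) \<in> ell2"
  by (rule ell2_mult_bounded[where K = "cmod c"]) auto

lemma ell2_uminus: "\<phi> \<in> ell2 \<Longrightarrow> (\<lambda>x. - \<phi> x) \<in> ell2"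
  using ell2_scale[of \<phi> "-1"] by simp

lemma ell2_diff: "\<phi> \<in> ell2 \<Longrightarrow> \<psi> \<in> ell2 \<Longrightarrow> (\<lambda>x. \<phi> x - \<psi> x) \<in> ell2"
  using ell2_add[OF _ ell2_uminus, of \<phi> \<psi>] by simp

lemma ell2_summable: "\<phi> \<in> ell2 \<Longrightarrow> (\<lambda>x. (cmod (\<phi> x))\<^sup>2) summable_on A"
  unfolding ell2_def mem_Collect_eq by (erule summable_on_subset) simp

lemma abs_summable_ell2_inner:
  assumes "\<phi> \<in> ell2" "\<psi> \<in> ell2"
  shows "(\<lambda>x. cmod (cnj (\<phi> x) * \<psi> x)) summable_on A"
proof -
  have "(\<lambda>x. (cmod (\<phi> x))\<^sup>2 + (cmod (\<psi> x))\<^sup>2) summable_on A"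
    using assms by (intro summable_on_add ell2_summable)
  then show ?thesis
  proof (rule summable_on_comparison_test)
    fix x
    show "cmod (cnj (\<phi> x) * \<psi> x) \<le> (cmod (\<phi> x))\<^sup>2 + (cmod (\<psi> x))\<^sup>2"
      using sum_squares_bound[of "cmod (\<phi> x)" "cmod (\<psi> x)"]
        mult_nonneg_nonneg[OF norm_ge_zero norm_ge_zero, of "\<phi> x" "\<psi> x"]
      unfolding norm_mult complex_mod_cnj by linarith
  qed simp
qed

lemma summable_ell2_inner:
  "\<phi> \<in> ell2 \<Longrightarrow> \<psi> \<in> ell2 \<Longrightarrow> (\<lambda>x. cnj (\<phi> x) * \<psi> x) summable_on A"
  by (rule abs_summable_summable[OF abs_summable_ell2_inner])

lemma ell2_inner_add_right:
  "\<phi> \<in> ell2 \<Longrightarrow> \<psi> \<in> ell2 \<Longrightarrow> \<theta> \<in> ell2 \<Longrightarrow>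
    ell2_inner \<phi> (\<lambda>x. \<psi> x + \<theta> x) = ell2_inner \<phi> \<psi> + ell2_inner \<phi> \<theta>"
  unfolding ell2_inner_def by (simp add: distrib_left infsum_add summable_ell2_inner)

lemma ell2_inner_scale_right: "ell2_inner \<phi> (\<lambda>x. c * \<psi> x) = c * ell2_inner \<phi> \<psi>"
  unfolding ell2_inner_def by (subst infsum_cmult_right'[symmetric]) (simp add: mult_ac)

lemma ell2_inner_cnj: "ell2_inner \<phi> \<psi> = cnj (ell2_inner \<psi> \<phi>)"
  unfolding ell2_inner_def by (subst infsum_cnj[symmetric]) (simp add: mult_ac)

lemma ell2_inner_finite:
  assumes "finite A" "\<And>x. x \<notin> A \<Longrightarrow> \<phi> x = 0 \<or> \<psi> x = 0"
  shows "ell2_inner \<phi> \<psi> = (\<Sum>x\<in>A. cnj (\<phi> x) * \<psi> x)"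
proof -
  have "ell2_inner \<phi> \<psi> = infsum (\<lambda>x. cnj (\<phi> x) * \<psi> x) A"
    unfolding ell2_inner_def using assms(2) by (intro infsum_cong_neutral) auto
  then show ?thesis using assms(1) by simp
qed

lemma ell2_inner_delta: "ell2_inner (delta x) \<psi> = \<psi> x"
  by (subst ell2_inner_finite[of "{x}"]) (auto simp: delta_def)

lemma ell2_delta: "delta x \<in> ell2"
  by (rule finite_support_ell2) (simp add: delta_def)

text \<open>Outside a suitable finite set \<open>g\<close> has small norm and the uniform bound
  controls the rest; on the finite set pointwise convergence suffices.\<close>

lemma ell2_weak_tendsto:
  fixes h :: "nat \<Rightarrow> 'v \<Rightarrow> complex"
  assumes bound: "\<And>n A. finite A \<Longrightarrow> (\<Sum>x\<in>A. (cmod (h n x))\<^sup>2) \<le> R"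
    and lim: "\<And>x. (\<lambda>n. h n x) \<longlonglongrightarrow> \<phi> x" and g: "g \<in> ell2"
  shows "(\<lambda>n. ell2_inner (h n) g) \<longlonglongrightarrow> ell2_inner \<phi> g"
proof -
  have R: "0 \<le> R" using bound[of "{}"] by simp
  have h: "h n \<in> ell2" for n
    by (rule ell2I[OF bound])
  have \<phi>_bound: "(\<Sum>x\<in>A. (cmod (\<phi> x))\<^sup>2) \<le> R" if "finite A" for A
    by (rule LIMSEQ_le_const2[of "\<lambda>n. \<Sum>x\<in>A. (cmod (h n x))\<^sup>2"])
      (use bound[OF that] lim in \<open>auto intro!: tendsto_sum tendsto_power tendsto_norm\<close>)
  then have \<phi>: "\<phi> \<in> ell2" by (rule ell2I)
  define k where "k n x = h n x - \<phi> x" for n x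
  have k: "k n \<in> ell2" for n
    unfolding k_def by (intro ell2_diff h \<phi>)
  have k_bound: "(\<Sum>x\<in>A. (cmod (k n x))\<^sup>2) \<le> 4 * R" if "finite A" for n A
  proof -
    have "(\<Sum>x\<in>A. (cmod (k n x))\<^sup>2) \<le> (\<Sum>x\<in>A. 2 * (cmod (h n x))\<^sup>2 + 2 * (cmod (- \<phi> x))\<^sup>2)"
      unfolding k_def diff_conv_add_uminus by (intro sum_mono norm_add_squared_le)
    also have "\<dots> \<le> 4 * R"
      using bound[OF that, of n] \<phi>_bound[OF that] by (simp add: sum.distrib sum_distrib_left[symmetric])
    finally show ?thesis .
  qed
  have "(\<lambda>n. ell2_inner (k n) g) \<longlonglongrightarrow> 0"
  proof (rule LIMSEQ_I)
    fix \<epsilon> :: real assume "0 < \<epsilon>"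
    \<comment> \<open>\<open>4 * R\<close> bounds the squared norms of the differences
      \<open>k n\<close>; the summand 1 keeps \<open>c\<close> positive when
      \<open>R = 0\<close>.\<close>
    define c where "c = 4 * R + 1"
    have c: "0 < c" using R by (simp add: c_def)
    define \<delta> where "\<delta> = \<epsilon> / (3 * c)"
    have \<delta>: "0 < \<delta>" using \<open>0 < \<epsilon>\<close> c by (simp add: \<delta>_def)
    have "\<delta> * (4 * R) \<le> \<delta> * c"
      using \<delta> by (intro mult_left_mono) (auto simp: c_def)
    then have \<delta>R: "3 * (\<delta> * (4 * R)) \<le> \<epsilon>"
      using c by (simp add: \<delta>_def)
    have gs: "(\<lambda>x. (cmod (g x))\<^sup>2) summable_on A" for A
      by (rule ell2_summable[OF g])
    obtain F where F: "finite F"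
      and Fd: "dist (\<Sum>x\<in>F. (cmod (g x))\<^sup>2) (\<Sum>\<^sub>\<infinity>x. (cmod (g x))\<^sup>2) \<le> \<delta> * (\<epsilon> / 3)"
      using infsum_finite_approximation[OF gs, of "\<delta> * (\<epsilon> / 3)" UNIV] \<delta> \<open>0 < \<epsilon>\<close> by auto
    have "(\<Sum>\<^sub>\<infinity>x. (cmod (g x))\<^sup>2) = (\<Sum>x\<in>F. (cmod (g x))\<^sup>2) + (\<Sum>\<^sub>\<infinity>x\<in>-F. (cmod (g x))\<^sup>2)"
      using F infsum_Un_disjoint[OF gs gs, of F "-F"] by (simp add: Compl_partition)
    with Fd have tail: "(\<Sum>\<^sub>\<infinity>x\<in>-F. (cmod (g x))\<^sup>2) \<le> \<delta> * (\<epsilon> / 3)"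
      by (simp add: dist_real_def)
    have "(\<lambda>n. \<Sum>x\<in>F. cmod (k n x) * cmod (g x)) \<longlonglongrightarrow> (\<Sum>x\<in>F. cmod (\<phi> x - \<phi> x) * cmod (g x))"
      unfolding k_def by (intro tendsto_intros lim)
    then have "\<forall>\<^sub>F n in sequentially. (\<Sum>x\<in>F. cmod (k n x) * cmod (g x)) < \<epsilon> / 3"
      using \<open>0 < \<epsilon>\<close> by (intro order_tendstoD) auto
    then obtain N where N: "\<And>n. n \<ge> N \<Longrightarrow> (\<Sum>x\<in>F. cmod (k n x) * cmod (g x)) < \<epsilon> / 3"
      by (auto simp: eventually_sequentially)
    have "norm (ell2_inner (k n) g - 0) < \<epsilon>" if "n \<ge> N" for n
    proof -
      let ?f = "\<lambda>x. cmod (cnj (k n x) * g x)"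
      note fs = abs_summable_ell2_inner[OF k g, of n]
      have ks: "(\<lambda>x. (cmod (k n x))\<^sup>2) summable_on A" for A
        by (rule ell2_summable[OF k])
      have "cmod (ell2_inner (k n) g) \<le> infsum ?f UNIV"
        unfolding ell2_inner_def by (rule norm_infsum_bound[OF fs])
      also have "\<dots> = (\<Sum>x\<in>F. ?f x) + infsum ?f (-F)"
        using F infsum_Un_disjoint[OF fs fs, of F "-F"] by (simp add: Compl_partition)
      also have "infsum ?f (-F) \<le> (\<Sum>\<^sub>\<infinity>x\<in>-F. \<delta> / 2 * (cmod (k n x))\<^sup>2 + 1 / (2 * \<delta>) * (cmod (g x))\<^sup>2)"
      proof (rule infsum_mono[OF fs])
        show "(\<lambda>x. \<delta> / 2 * (cmod (k n x))\<^sup>2 + 1 / (2 * \<delta>) * (cmod (g x))\<^sup>2) summable_on - F"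
          by (intro summable_on_add summable_on_cmult_right ks gs)
        fix x
        \<comment> \<open>The arithmetic-geometric mean inequality, weighted by
          \<open>\<delta>\<close> so that the bounded factor and the tail of \<open>g\<close> each
          contribute at most \<open>\<epsilon> / 6\<close>.\<close>
        have "0 \<le> (\<delta> * cmod (k n x) - cmod (g x))\<^sup>2 / (2 * \<delta>)"
          using \<delta> by simp
        also have "\<dots> = \<delta> / 2 * (cmod (k n x))\<^sup>2 + 1 / (2 * \<delta>) * (cmod (g x))\<^sup>2 - ?f x"
          using \<delta> by (simp add: norm_mult power2_eq_square field_simps)
        finally show "?f x \<le> \<delta> / 2 * (cmod (k n x))\<^sup>2 + 1 / (2 * \<delta>) * (cmod (g x))\<^sup>2"
          by simp
      qed
      also have "\<dots> = \<delta> / 2 * (\<Sum>\<^sub>\<infinity>x\<in>-F. (cmod (k n x))\<^sup>2) + 1 / (2 * \<delta>) * (\<Sum>\<^sub>\<infinity>x\<in>-F. (cmod (g x))\<^sup>2)"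
        by (subst infsum_add) (intro summable_on_cmult_right ks gs, intro summable_on_cmult_right ks gs,
          simp only: infsum_cmult_right')
      also have "\<dots> \<le> \<delta> / 2 * (4 * R) + 1 / (2 * \<delta>) * (\<delta> * (\<epsilon> / 3))"
      proof (intro add_mono mult_left_mono tail)
        show "(\<Sum>\<^sub>\<infinity>x\<in>-F. (cmod (k n x))\<^sup>2) \<le> 4 * R"
          by (intro infsum_le_finite_sums ks k_bound)
      qed (use \<delta> in auto)
      also have "(\<Sum>x\<in>F. ?f x) + (\<delta> / 2 * (4 * R) + 1 / (2 * \<delta>) * (\<delta> * (\<epsilon> / 3))) < \<epsilon>"
      proof -
        have "\<delta> / 2 * (4 * R) \<le> \<epsilon> / 6" using \<delta>R by (simp add: mult.commute)
        moreover have "1 / (2 * \<delta>) * (\<delta> * (\<epsilon> / 3)) = \<epsilon> / 6" using \<delta> by simp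
        moreover have "(\<Sum>x\<in>F. ?f x) < \<epsilon> / 3" using N[OF that] by (simp add: norm_mult)
        moreover have "A + (P + Q) < \<epsilon>" if "P \<le> \<epsilon> / 6" "Q = \<epsilon> / 6" "A < \<epsilon> / 3" for A P Q :: real
          using that \<open>0 < \<epsilon>\<close> by linarith
        ultimately show ?thesis by blast
      qed
      finally show ?thesis by simp
    qed
    then show "\<exists>N. \<forall>n\<ge>N. norm (ell2_inner (k n) g - 0) < \<epsilon>" by blast
  qed
  moreover have "ell2_inner (h n) g = ell2_inner (k n) g + ell2_inner \<phi> g" for n
    using ell2_inner_add_right[OF g k[of n] \<phi>]
    by (subst (1 2 3) ell2_inner_cnj) (simp add: k_def)
  ultimately show ?thesis
    using tendsto_add[of "\<lambda>n. ell2_inner (k n) g" 0 sequentially "\<lambda>_. ell2_inner \<phi> g"] by simp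
qed

text \<open>Tychonoff's theorem for a product of closed discs.\<close>

lemma compact_bounded_functions:
  "compact {g :: 'v \<Rightarrow> complex. \<forall>x. cmod (g x) \<le> r}"
proof -
  have "compactin (product_topology (\<lambda>_. euclidean) UNIV) (PiE UNIV (\<lambda>_::'v. cball (0::complex) r))"
    by (simp add: compactin_PiE)
  then have "compact (PiE UNIV (\<lambda>_::'v. cball (0::complex) r))"
    by (simp add: euclidean_product_topology)
  also have "PiE UNIV (\<lambda>_::'v. cball (0::complex) r) = {g. \<forall>x. cmod (g x) \<le> r}"
    by auto
  finally show ?thesis .
qed

section \<open>Limits of finite-volume solutions and the maximum principle\<close>

context lf_graph
begin

lemma continuous_hop: "continuous_on UNIV (\<lambda>g. hop d g x)"
  unfolding hop_def by (intro continuous_intros continuous_on_product_coordinates)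

text \<open>The norm bound places all \<open>\<phi> n\<close> in a set that is compact for pointwise
  convergence. Each equation involves finitely many coordinates, so every cluster point solves all
  of them; uniqueness leaves one cluster point, hence convergence.\<close>

lemma hop_limit:
  fixes B :: "nat \<Rightarrow> 'v set"
  assumes fin: "\<And>n. finite (B n)" and exh: "\<And>x. \<forall>\<^sub>F n in sequentially. x \<in> B n"
    and d: "\<And>x. Im (d x) = e" "e \<noteq> 0"
    and f: "f \<in> ell2"
    and sol: "\<And>n. fv_sol d (B n) f (\<phi> n)"
    and unique: "\<And>\<theta>. \<theta> \<in> ell2 \<Longrightarrow> (\<And>x. hop d \<theta> x = 0) \<Longrightarrow> \<theta> = (\<lambda>_. 0)"
  obtains \<psi> R where "\<psi> \<in> ell2" "\<And>x. hop d \<psi> x = f x" "\<And>x. (\<lambda>n. \<phi> n x) \<longlonglongrightarrow> \<psi> x"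
    "\<And>n A. finite A \<Longrightarrow> (\<Sum>x\<in>A. (cmod (\<phi> n x))\<^sup>2) \<le> R"
proof -
  define R where "R = (\<Sum>\<^sub>\<infinity>x. (cmod (f x))\<^sup>2) / e\<^sup>2"
  have bound: "(\<Sum>x\<in>A. (cmod (\<phi> n x))\<^sup>2) \<le> R" if "finite A" for n A
  proof -
    have "(\<Sum>x\<in>A. (cmod (\<phi> n x))\<^sup>2) = (\<Sum>x\<in>A \<inter> B n. (cmod (\<phi> n x))\<^sup>2)"
      using sol[of n] that by (intro sum.mono_neutral_right) (auto simp: fv_sol_def)
    also have "\<dots> \<le> (\<Sum>x\<in>B n. (cmod (\<phi> n x))\<^sup>2)"
      using fin by (intro sum_mono2) auto
    finally have "e\<^sup>2 * (\<Sum>x\<in>A. (cmod (\<phi> n x))\<^sup>2) \<le> e\<^sup>2 * (\<Sum>x\<in>B n. (cmod (\<phi> n x))\<^sup>2)"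
      by (intro mult_left_mono) auto
    also have "\<dots> = (\<bar>e\<bar> * L2_set (\<lambda>x. cmod (\<phi> n x)) (B n))\<^sup>2"
      by (simp add: power_mult_distrib L2_set_def sum_nonneg)
    also have "\<dots> \<le> (L2_set (\<lambda>x. cmod (f x)) (B n))\<^sup>2"
      using fv_sol_norm_le[OF fin d(1) sol, of n] by (intro power_mono) (auto simp: L2_set_nonneg)
    also have "\<dots> = (\<Sum>x\<in>B n. (cmod (f x))\<^sup>2)"
      by (simp add: L2_set_def sum_nonneg)
    also have "\<dots> \<le> (\<Sum>\<^sub>\<infinity>x. (cmod (f x))\<^sup>2)"
      by (rule ell2_sum_le[OF f fin])
    finally show ?thesis
      using d(2) by (simp add: R_def pos_le_divide_eq mult.commute)
  qed
  have cont_sum: "continuous_on UNIV (\<lambda>g. \<Sum>x\<in>A. (cmod (g x))\<^sup>2)" for A :: "'v set"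
    by (intro continuous_intros continuous_on_product_coordinates)
  define Q where "Q = {g :: 'v \<Rightarrow> complex. \<forall>A. finite A \<longrightarrow> (\<Sum>x\<in>A. (cmod (g x))\<^sup>2) \<le> R}"
  have "closed Q"
    unfolding Q_def
    by (intro closed_Collect_all closed_Collect_imp closed_Collect_le cont_sum continuous_on_const) auto
  moreover have "Q \<subseteq> {g. \<forall>x. cmod (g x) \<le> sqrt R}"
    unfolding Q_def by (auto intro!: real_le_rsqrt dest: spec[of _ "{_}"])
  ultimately have "compact Q"
    using compact_Int_closed[OF compact_bounded_functions] by (metis inf.absorb_iff2)
  have \<phi>Q: "\<phi> n \<in> Q" for n
    using bound by (simp add: Q_def)
  \<comment> \<open>Proper filters finer than the sequence take the place of subsequences. The last
    clause places the cluster point in every closed set that the filter eventually enters.\<close>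
  have cluster: "\<exists>\<theta>. \<theta> \<in> ell2 \<and> (\<forall>x. hop d \<theta> x = f x) \<and> (\<forall>C. closed C \<longrightarrow> (\<forall>\<^sub>F g in F. g \<in> C) \<longrightarrow> \<theta> \<in> C)"
    if F: "F \<noteq> bot" "F \<le> filtermap \<phi> sequentially" for F
  proof -
    have ev: "\<forall>\<^sub>F g in F. P g" if "\<forall>\<^sub>F n in sequentially. P (\<phi> n)" for P
      using F(2) that by (auto simp: le_filter_def eventually_filtermap)
    have "\<forall>\<^sub>F g in F. g \<in> Q"
      by (rule ev) (simp add: \<phi>Q)
    then obtain \<theta> where \<theta>: "\<theta> \<in> Q" "inf (nhds \<theta>) F \<noteq> bot"
      using \<open>compact Q\<close> F(1) unfolding compact_filter by blast
    have cl: "\<theta> \<in> C" if "closed C" "\<forall>\<^sub>F g in F. g \<in> C" for C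
    proof (rule ccontr)
      assume "\<theta> \<notin> C"
      then have "\<forall>\<^sub>F g in nhds \<theta>. g \<in> - C"
        using that(1) by (intro eventually_nhds_in_open) auto
      with that(2) have "\<forall>\<^sub>F g in inf (nhds \<theta>) F. False"
        unfolding eventually_inf by (intro exI[of _ "\<lambda>g. g \<in> - C"] exI[of _ "\<lambda>g. g \<in> C"]) auto
      with \<theta>(2) show False by (simp add: eventually_False)
    qed
    have "\<theta> \<in> {g. hop d g x = f x}" for x
    proof (rule cl)
      show "closed {g. hop d g x = f x}"
        by (intro closed_Collect_eq continuous_hop continuous_on_const)
      show "\<forall>\<^sub>F g in F. g \<in> {g. hop d g x = f x}"
        using exh[of x] by (intro ev) (auto elim!: eventually_mono simp: sol[unfolded fv_sol_def])
    qed
    moreover have "\<theta> \<in> ell2"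
      using \<theta>(1) by (intro ell2I[where R = R]) (auto simp: Q_def)
    ultimately show ?thesis using cl by blast
  qed
  obtain \<psi> where \<psi>: "\<psi> \<in> ell2" "\<And>x. hop d \<psi> x = f x"
    using cluster[of "filtermap \<phi> sequentially"] by (auto simp: filtermap_bot_iff)
  have "(\<lambda>n. \<phi> n x) \<longlonglongrightarrow> \<psi> x" for x
  proof (rule ccontr)
    assume "\<not> (\<lambda>n. \<phi> n x) \<longlonglongrightarrow> \<psi> x"
    then obtain \<epsilon> where \<epsilon>: "0 < \<epsilon>" "\<not> (\<forall>\<^sub>F n in sequentially. dist (\<phi> n x) (\<psi> x) < \<epsilon>)"
      by (auto simp: tendsto_iff)
    define C where "C = {g :: 'v \<Rightarrow> complex. \<epsilon> \<le> dist (g x) (\<psi> x)}"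
    have "closed C"
      unfolding C_def
      by (intro closed_Collect_le continuous_intros continuous_on_product_coordinates)
    \<comment> \<open>Without convergence the sequence meets \<open>C\<close> infinitely often. A
      cluster point of the filter restricted to \<open>C\<close> stays at distance at least
      \<open>\<epsilon>\<close> from \<open>\<psi>\<close> at \<open>x\<close>, while uniqueness
      makes it equal to \<open>\<psi>\<close>.\<close>
    have "inf (filtermap \<phi> sequentially) (principal C) \<noteq> bot"
    proof
      assume "inf (filtermap \<phi> sequentially) (principal C) = bot"
      then have "\<forall>\<^sub>F g in inf (filtermap \<phi> sequentially) (principal C). False"
        by simp
      then have "\<forall>\<^sub>F n in sequentially. dist (\<phi> n x) (\<psi> x) < \<epsilon>"
        by (simp add: eventually_inf_principal eventually_filtermap C_def not_le)
      with \<epsilon>(2) show False by contradiction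
    qed
    from cluster[OF this] obtain \<theta> where \<theta>: "\<theta> \<in> ell2" "\<And>x. hop d \<theta> x = f x"
      and cl: "\<And>C'. closed C' \<Longrightarrow> \<forall>\<^sub>F g in inf (filtermap \<phi> sequentially) (principal C). g \<in> C' \<Longrightarrow> \<theta> \<in> C'"
      by auto
    have "(\<lambda>x. \<theta> x - \<psi> x) = (\<lambda>_. 0)"
      using \<theta> \<psi> by (intro unique ell2_diff) (simp_all add: hop_diff)
    then have "\<theta> x = \<psi> x" by (metis eq_iff_diff_eq_0)
    moreover have "\<theta> \<in> C"
      using \<open>closed C\<close> by (intro cl) (simp_all add: eventually_inf_principal)
    ultimately show False using \<epsilon>(1) by (simp add: C_def)
  qed
  with that \<psi> bound show ?thesis by blast
qed

text \<open>The modulus of a nonzero square-summable function attains its maximum, because its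
  superlevel sets at positive heights are finite. At a maximum the equation forces
  \<open>cmod (d x)\<close> to be at most the valence.\<close>

lemma maximum_principle:
  assumes \<phi>: "\<phi> \<in> ell2" and hop: "\<And>x. hop d \<phi> x = 0"
    and d: "\<And>x. real (valence adj x) < cmod (d x)"
  shows "\<phi> = (\<lambda>_. 0)"
proof (rule ccontr)
  assume "\<phi> \<noteq> (\<lambda>_. 0)"
  then obtain x0 where x0: "\<phi> x0 \<noteq> 0" by auto
  define c where "c = cmod (\<phi> x0)"
  have c: "0 < c" using x0 by (simp add: c_def)
  define S where "S = {x. c \<le> cmod (\<phi> x)}"
  have "finite S"
  proof (rule finite_if_finite_subsets_card_bdd[THEN conjunct1])
    fix A assume A: "A \<subseteq> S" "finite A"
    have "card A * c\<^sup>2 = (\<Sum>x\<in>A. c\<^sup>2)" by simp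
    also have "\<dots> \<le> (\<Sum>x\<in>A. (cmod (\<phi> x))\<^sup>2)"
      using A c by (intro sum_mono power_mono) (auto simp: S_def)
    also have "\<dots> \<le> (\<Sum>\<^sub>\<infinity>x. (cmod (\<phi> x))\<^sup>2)"
      by (rule ell2_sum_le[OF \<phi> A(2)])
    finally have "card A \<le> (\<Sum>\<^sub>\<infinity>x. (cmod (\<phi> x))\<^sup>2) / c\<^sup>2"
      using c by (simp add: pos_le_divide_eq)
    then show "card A \<le> nat \<lceil>(\<Sum>\<^sub>\<infinity>x. (cmod (\<phi> x))\<^sup>2) / c\<^sup>2\<rceil>"
      by linarith
  qed
  moreover have "x0 \<in> S" by (simp add: S_def c_def)
  ultimately have "Max ((\<lambda>x. cmod (\<phi> x)) ` S) \<in> (\<lambda>x. cmod (\<phi> x)) ` S"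
    by (intro Max_in) auto
  then obtain x where x: "x \<in> S" "\<And>y. y \<in> S \<Longrightarrow> cmod (\<phi> y) \<le> cmod (\<phi> x)"
    using Max_ge[OF finite_imageI[OF \<open>finite S\<close>], of _ "\<lambda>x. cmod (\<phi> x)"] by fastforce
  have max: "cmod (\<phi> y) \<le> cmod (\<phi> x)" for y
    using x by (cases "y \<in> S") (auto simp: S_def)
  have "cmod (d x) * cmod (\<phi> x) = cmod (\<Sum>y | adj x y. \<phi> y)"
    using hop[of x] by (simp add: hop_def flip: norm_mult)
  also have "\<dots> \<le> (\<Sum>y | adj x y. cmod (\<phi> x))"
    by (intro sum_norm_le max)
  also have "\<dots> = valence adj x * cmod (\<phi> x)"
    by (simp add: valence_def)
  finally have "cmod (d x) \<le> valence adj x"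
    using x(1) c by (subst (asm) mult_le_cancel_right_pos) (auto simp: S_def)
  with d[of x] show False by simp
qed

end

section \<open>Exhaustion of the graph and essential selfadjointness of the Laplacian\<close>

locale conn_graph = lf_graph +
  assumes connected: "connected_graph adj"
begin

lemma finite_walks: "finite (walks adj x n)"
proof (induction n arbitrary: x)
  case 0
  have "walks adj x 0 \<subseteq> {[x]}"
    by (auto simp: walks_def length_Suc_conv)
  then show ?case by (rule finite_subset) simp
next
  case (Suc n)
  have "walks adj x (Suc n) \<subseteq> (\<Union>b\<in>{b. adj x b}. (#) x ` walks adj b n)"
  proof
    fix xs assume xs: "xs \<in> walks adj x (Suc n)"
    then obtain ys where "xs = x # ys" "length ys = Suc n"
      by (cases xs) (auto simp: walks_def)
    then have ys: "xs = x # ys" "ys \<noteq> []" by auto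
    with xs have "adj x (hd ys)" "ys \<in> walks adj (hd ys) n"
      by (auto simp: walks_def successively_Cons)
    with ys show "xs \<in> (\<Union>b\<in>{b. adj x b}. (#) x ` walks adj b n)" by blast
  qed
  then show ?case
    by (rule finite_subset) (intro finite_UN_I finite_nbrs finite_imageI Suc)
qed

text \<open>Every vertex is the end of a walk from a fixed one, and there are only finitely many
  walks of each length.\<close>

lemma countable_vertices: "countable (UNIV :: 'a set)"
proof -
  fix x :: 'a
  have "UNIV \<subseteq> (\<Union>n. last ` walks adj x n)"
  proof
    fix y
    obtain n xs where "xs \<in> walks adj x n" "last xs = y"
      using connected unfolding connected_graph_def by metis
    then show "y \<in> (\<Union>n. last ` walks adj x n)" by auto
  qed
  moreover have "countable (\<Union>n. last ` walks adj x n)"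
    by (rule countable_UN[OF countableI_type]) (intro countable_finite finite_imageI finite_walks)
  ultimately show ?thesis by (rule countable_subset)
qed

text \<open>Initial segments of an enumeration: \<open>hop_limit\<close> asks only for finite sets
  that eventually contain each vertex.\<close>

definition exhaustion :: "nat \<Rightarrow> 'a set" where
  "exhaustion n = from_nat_into UNIV ` {..n}"

lemma finite_exhaustion: "finite (exhaustion n)"
  by (simp add: exhaustion_def)

lemma eventually_exhaustion: "\<forall>\<^sub>F n in sequentially. x \<in> exhaustion n"
proof -
  have "x = from_nat_into UNIV (to_nat_on UNIV x)"
    using countable_vertices by simp
  then have "x \<in> exhaustion n" if "to_nat_on UNIV x \<le> n" for n
    unfolding exhaustion_def using that by (intro image_eqI[of _ _ "to_nat_on UNIV x"]) auto
  then show ?thesis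
    unfolding eventually_sequentially by blast
qed

definition deg :: "'a \<Rightarrow> complex" where
  "deg x = of_nat (valence adj x)"

text \<open>Both \<open>deg + 1 - \<i>\<close> and its conjugate have constant nonzero imaginary part, so that
  finite-volume problems are solvable, and exceed the valence in modulus, so that \<open>ell2\<close>
  solutions are unique. Hence finite-volume solutions approximate any element of the maximal
  domain, and the symmetry of the finite sections passes to the limit.\<close>

lemma hop_deg_symmetric:
  assumes \<phi>: "\<phi> \<in> ell2" "hop deg \<phi> \<in> ell2" and \<psi>: "\<psi> \<in> ell2" "hop deg \<psi> \<in> ell2"
  shows "ell2_inner \<phi> (hop deg \<psi>) = ell2_inner (hop deg \<phi>) \<psi>"
proof -
  define d where "d x = deg x + (1 - \<i>)" for x
  have hop_shift: "hop (\<lambda>x. deg x + c) \<theta> x = hop deg \<theta> x + c * \<theta> x" for c \<theta> x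
    by (simp add: hop_def algebra_simps)
  \<comment> \<open>The real part alone exceeds the valence by 1; \<open>t = -1\<close> and
    \<open>t = 1\<close> cover \<open>d\<close> and its conjugate.\<close>
  have big: "real m < cmod (of_nat m + (1 + of_real t * \<i>))" for m t
  proof -
    have "real m < \<bar>Re (of_nat m + (1 + of_real t * \<i>))\<bar>" by simp
    also have "\<dots> \<le> cmod (of_nat m + (1 + of_real t * \<i>))" by (rule abs_Re_le_cmod)
    finally show ?thesis .
  qed
  define g where "g = hop d \<psi>"
  define f where "f = hop (\<lambda>x. cnj (d x)) \<phi>"
  have cnj_d: "cnj (d x) = deg x + (1 + \<i>)" for x
    by (simp add: d_def deg_def)
  have g_eq: "g = (\<lambda>x. hop deg \<psi> x + (1 - \<i>) * \<psi> x)"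
    unfolding g_def d_def by (simp add: fun_eq_iff hop_shift)
  have f_eq: "f = (\<lambda>x. hop deg \<phi> x + (1 + \<i>) * \<phi> x)"
    unfolding f_def cnj_d by (simp add: fun_eq_iff hop_shift)
  have g: "g \<in> ell2"
    unfolding g_eq by (intro ell2_add ell2_scale \<psi>)
  have f: "f \<in> ell2"
    unfolding f_eq by (intro ell2_add ell2_scale \<phi>)
  have Im_d: "Im (d x) = -1" "Im (cnj (d x)) = 1" for x
    by (simp_all add: d_def deg_def)
  have nonzero: "- 1 \<noteq> (0::real)" "1 \<noteq> (0::real)" by simp_all
  have uniq_d: "\<theta> = (\<lambda>_. 0)" if "\<theta> \<in> ell2" "\<And>x. hop d \<theta> x = 0" for \<theta>
    using that by (rule maximum_principle) (use big[of _ "-1"] in \<open>simp add: d_def deg_def\<close>)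
  have uniq_d': "\<theta> = (\<lambda>_. 0)" if "\<theta> \<in> ell2" "\<And>x. hop (\<lambda>x. cnj (d x)) \<theta> x = 0" for \<theta>
    using that by (rule maximum_principle) (use big[of _ 1] in \<open>simp add: cnj_d deg_def\<close>)
  have "\<forall>n. \<exists>\<theta>. fv_sol d (exhaustion n) g \<theta>"
    using fv_sol_exists[OF finite_exhaustion Im_d(1)] by fastforce
  then obtain \<psi>n where \<psi>n: "\<And>n. fv_sol d (exhaustion n) g (\<psi>n n)" by metis
  have "\<forall>n. \<exists>\<theta>. fv_sol (\<lambda>x. cnj (d x)) (exhaustion n) f \<theta>"
    using fv_sol_exists[OF finite_exhaustion Im_d(2)] by fastforce
  then obtain \<phi>n where \<phi>n: "\<And>n. fv_sol (\<lambda>x. cnj (d x)) (exhaustion n) f (\<phi>n n)" by metis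
  obtain \<psi>' R where \<psi>': "\<psi>' \<in> ell2" "\<And>x. hop d \<psi>' x = g x" "\<And>x. (\<lambda>n. \<psi>n n x) \<longlonglongrightarrow> \<psi>' x"
    "\<And>n A. finite A \<Longrightarrow> (\<Sum>x\<in>A. (cmod (\<psi>n n x))\<^sup>2) \<le> R"
    by (rule hop_limit[where d = d and e = "-1" and B = exhaustion and f = g and \<phi> = \<psi>n])
      (assumption | rule finite_exhaustion eventually_exhaustion Im_d nonzero g \<psi>n uniq_d that)+
  \<comment> \<open>The limit and \<open>\<psi>\<close> solve the same equation, so the
    finite-volume solutions converge to the given \<open>\<psi>\<close>.\<close>
  have "(\<lambda>x. \<psi>' x - \<psi> x) = (\<lambda>_. 0)"
    using \<psi>' \<psi> by (intro uniq_d ell2_diff) (simp_all add: hop_diff g_def)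
  then have [simp]: "\<psi>' = \<psi>" by (simp add: fun_eq_iff)
  obtain \<phi>' R' where \<phi>': "\<phi>' \<in> ell2" "\<And>x. hop (\<lambda>x. cnj (d x)) \<phi>' x = f x" "\<And>x. (\<lambda>n. \<phi>n n x) \<longlonglongrightarrow> \<phi>' x"
    "\<And>n A. finite A \<Longrightarrow> (\<Sum>x\<in>A. (cmod (\<phi>n n x))\<^sup>2) \<le> R'"
    by (rule hop_limit[where d = "\<lambda>x. cnj (d x)" and e = 1 and B = exhaustion and f = f and \<phi> = \<phi>n])
      (assumption | rule finite_exhaustion eventually_exhaustion Im_d nonzero f \<phi>n uniq_d' that)+
  have "(\<lambda>x. \<phi>' x - \<phi> x) = (\<lambda>_. 0)"
    using \<phi>' \<phi> by (intro uniq_d' ell2_diff) (simp_all add: hop_diff f_def)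
  then have [simp]: "\<phi>' = \<phi>" by (simp add: fun_eq_iff)
  have fin: "ell2_inner (\<phi>n n) g = ell2_inner f (\<psi>n n)" for n
  proof -
    have "ell2_inner (\<phi>n n) g = (\<Sum>x\<in>exhaustion n. cnj (\<phi>n n x) * hop d (\<psi>n n) x)"
      using \<phi>n[of n] \<psi>n[of n] by (subst ell2_inner_finite[OF finite_exhaustion[of n]]) (auto simp: fv_sol_def)
    also have "\<dots> = (\<Sum>x\<in>exhaustion n. cnj (hop (\<lambda>x. cnj (d x)) (\<phi>n n) x) * \<psi>n n x)"
      using \<phi>n[of n] \<psi>n[of n] by (intro hop_symmetric finite_exhaustion) (auto simp: fv_sol_def)
    also have "\<dots> = ell2_inner f (\<psi>n n)"
      using \<phi>n[of n] \<psi>n[of n] by (subst ell2_inner_finite[OF finite_exhaustion[of n]]) (auto simp: fv_sol_def)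
    finally show ?thesis .
  qed
  have "(\<lambda>n. ell2_inner (\<phi>n n) g) \<longlonglongrightarrow> ell2_inner \<phi> g"
    using \<phi>' by (intro ell2_weak_tendsto[of \<phi>n R'] g) auto
  moreover have "(\<lambda>n. cnj (ell2_inner (\<psi>n n) f)) \<longlonglongrightarrow> cnj (ell2_inner \<psi> f)"
    using \<psi>' by (intro tendsto_cnj ell2_weak_tendsto[of \<psi>n R] f) auto
  then have "(\<lambda>n. ell2_inner (\<phi>n n) g) \<longlonglongrightarrow> ell2_inner f \<psi>"
    unfolding fin by (simp flip: ell2_inner_cnj)
  ultimately have "ell2_inner \<phi> g = ell2_inner f \<psi>"
    by (rule LIMSEQ_unique)
  \<comment> \<open>It remains to remove the shifts. The constant \<open>1 + \<i>\<close> in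
    \<open>f\<close> is conjugated by the inner product, so both sides carry the same extra
    term.\<close>
  also have "ell2_inner f \<psi> = cnj (ell2_inner \<psi> f)"
    by (rule ell2_inner_cnj)
  also have "\<dots> = cnj (ell2_inner \<psi> (hop deg \<phi>)) + (1 - \<i>) * cnj (ell2_inner \<psi> \<phi>)"
    unfolding f_eq using \<phi> \<psi> by (simp add: ell2_inner_add_right ell2_scale ell2_inner_scale_right)
  also have "\<dots> = ell2_inner (hop deg \<phi>) \<psi> + (1 - \<i>) * ell2_inner \<phi> \<psi>"
    by (simp flip: ell2_inner_cnj)
  also have "ell2_inner \<phi> g = ell2_inner \<phi> (hop deg \<psi>) + (1 - \<i>) * ell2_inner \<phi> \<psi>"
    unfolding g_eq using \<phi> \<psi> by (simp add: ell2_inner_add_right ell2_scale ell2_inner_scale_right)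
  finally show ?thesis by simp
qed

text \<open>The formal Laplacian on its maximal domain; it turns out to be the extension selected by
  \<open>THE\<close> in \<open>laplacian\<close>.\<close>

definition max_laplacian :: "'a operator" where
  "max_laplacian = {(\<psi>, \<lambda>x. - hop deg \<psi> x) |\<psi>. \<psi> \<in> ell2 \<and> hop deg \<psi> \<in> ell2}"

lemma laplacian_c_eq: "laplacian_c adj = {(\<psi>, \<lambda>x. - hop deg \<psi> x) |\<psi>. finite {x. \<psi> x \<noteq> 0}}"
  by (simp add: laplacian_c_def hop_def deg_def)

lemma finite_support_hop:
  assumes "finite {x. \<psi> x \<noteq> 0}"
  shows "finite {x. hop d \<psi> x \<noteq> 0}"
proof (rule finite_subset)
  show "{x. hop d \<psi> x \<noteq> 0} \<subseteq> {x. \<psi> x \<noteq> 0} \<union> (\<Union>y\<in>{y. \<psi> y \<noteq> 0}. {x. adj y x})"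
  proof
    fix x assume "x \<in> {x. hop d \<psi> x \<noteq> 0}"
    then have "\<psi> x \<noteq> 0 \<or> (\<Sum>y | adj x y. \<psi> y) \<noteq> 0" by (auto simp: hop_def)
    then show "x \<in> {x. \<psi> x \<noteq> 0} \<union> (\<Union>y\<in>{y. \<psi> y \<noteq> 0}. {x. adj y x})"
      using sum.not_neutral_contains_not_neutral[of \<psi> "{y. adj x y}"] adj_sym by blast
  qed
qed (use assms finite_nbrs in auto)

lemma laplacian_c_subset: "laplacian_c adj \<subseteq> max_laplacian"
  unfolding laplacian_c_eq max_laplacian_def
  using finite_support_ell2 finite_support_hop by fast

text \<open>Testing against \<open>delta x\<close> reads off \<open>\<eta> x\<close>: its image is
  supported on \<open>x\<close> and the neighbours of \<open>x\<close> and yields the formal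
  Laplacian of \<open>\<phi>\<close> there.\<close>

lemma adjoint_laplacian_c_subset: "adjoint_op (laplacian_c adj) \<subseteq> max_laplacian"
proof (rule subrelI)
  fix \<phi> \<eta> assume adj: "(\<phi>, \<eta>) \<in> adjoint_op (laplacian_c adj)"
  then have ell2: "\<phi> \<in> ell2" "\<eta> \<in> ell2" by (auto simp: adjoint_op_def)
  have "\<eta> x = - hop deg \<phi> x" for x
  proof -
    have fin: "finite {y. delta x y \<noteq> 0}" by (simp add: delta_def)
    then have "(delta x, \<lambda>y. - hop deg (delta x) y) \<in> laplacian_c adj"
      by (auto simp: laplacian_c_eq)
    with adj have "ell2_inner \<phi> (\<lambda>y. - hop deg (delta x) y) = ell2_inner \<eta> (delta x)"
      by (auto simp: adjoint_op_def)
    also have "\<dots> = cnj (\<eta> x)"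
      by (subst ell2_inner_cnj) (simp add: ell2_inner_delta)
    also have "ell2_inner \<phi> (\<lambda>y. - hop deg (delta x) y)
      = (\<Sum>y\<in>insert x {y. adj x y}. cnj (\<phi> y) * - hop deg (delta x) y)"
    proof (rule ell2_inner_finite)
      fix y assume "y \<notin> insert x {y. adj x y}"
      then show "\<phi> y = 0 \<or> - hop deg (delta x) y = 0"
        using sum_delta_nbrs(2)[where a = y and x = x] adj_commute[of x y]
        by (simp add: hop_def) (simp add: delta_def)
    qed (simp add: finite_nbrs)
    also have "\<dots> = cnj (\<phi> x) * - deg x + (\<Sum>y | adj x y. cnj (\<phi> y) * 1)"
    proof -
      have "hop deg (delta x) x = deg x"
        using sum_delta_nbrs(2)[where a = x and x = x] adj_irrefl[of x]
        by (simp add: hop_def) (simp add: delta_def)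
      moreover have "- hop deg (delta x) y = 1" if "adj x y" for y
        using sum_delta_nbrs(2)[where a = y and x = x] adj_commute[of x y] adj_irrefl[of x] that
        by (simp add: hop_def) (auto simp: delta_def)
      ultimately show ?thesis
        using adj_irrefl[of x] by (subst sum.insert) (auto simp: finite_nbrs)
    qed
    also have "\<dots> = cnj (- hop deg \<phi> x)"
      by (simp add: hop_def deg_def)
    finally show ?thesis by (metis complex_cnj_cancel_iff)
  qed
  then have "\<eta> = (\<lambda>x. - hop deg \<phi> x)" "hop deg \<phi> = (\<lambda>x. - \<eta> x)" by (simp_all add: fun_eq_iff)
  moreover have "(\<lambda>x. - \<eta> x) \<in> ell2"
    by (intro ell2_uminus ell2)
  ultimately show "(\<phi>, \<eta>) \<in> max_laplacian"
    using ell2 by (auto simp: max_laplacian_def)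
qed

lemma adjoint_op_antimono: "A \<subseteq> B \<Longrightarrow> adjoint_op B \<subseteq> adjoint_op A"
  by (auto simp: adjoint_op_def)

lemma densely_defined_max_laplacian: "densely_defined max_laplacian"
  unfolding densely_defined_def
proof (intro conjI ballI allI impI)
  show "Domain max_laplacian \<subseteq> ell2"
    by (auto simp: max_laplacian_def)
next
  fix \<phi> :: "'a \<Rightarrow> complex" and \<epsilon> :: real
  assume \<phi>: "\<phi> \<in> ell2" and \<epsilon>: "0 < \<epsilon>"
  have s: "(\<lambda>x. (cmod (\<phi> x))\<^sup>2) summable_on A" for A
    by (rule ell2_summable[OF \<phi>])
  obtain F where F: "finite F"
    and Fd: "dist (\<Sum>x\<in>F. (cmod (\<phi> x))\<^sup>2) (\<Sum>\<^sub>\<infinity>x. (cmod (\<phi> x))\<^sup>2) \<le> \<epsilon>\<^sup>2 / 2"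
    using infsum_finite_approximation[OF s, of "\<epsilon>\<^sup>2 / 2" UNIV] \<epsilon> by auto
  define \<psi> where "\<psi> x = (if x \<in> F then \<phi> x else 0)" for x
  have "(\<Sum>\<^sub>\<infinity>x. (cmod (\<phi> x))\<^sup>2) = (\<Sum>x\<in>F. (cmod (\<phi> x))\<^sup>2) + (\<Sum>\<^sub>\<infinity>x\<in>-F. (cmod (\<phi> x))\<^sup>2)"
    using F infsum_Un_disjoint[OF s s, of F "-F"] by (simp add: Compl_partition)
  with Fd have tail: "(\<Sum>\<^sub>\<infinity>x\<in>-F. (cmod (\<phi> x))\<^sup>2) \<le> \<epsilon>\<^sup>2 / 2"
    by (simp add: dist_real_def)
  have "(\<Sum>\<^sub>\<infinity>x. (cmod (\<phi> x - \<psi> x))\<^sup>2) = (\<Sum>\<^sub>\<infinity>x\<in>-F. (cmod (\<phi> x))\<^sup>2)"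
    by (intro infsum_cong_neutral) (auto simp: \<psi>_def)
  also have "\<dots> < \<epsilon>\<^sup>2"
    by (rule le_less_trans[OF tail]) (use \<epsilon> in simp)
  finally have "ell2_norm (\<lambda>x. \<phi> x - \<psi> x) < \<epsilon>"
    using \<epsilon> by (simp add: ell2_norm_def real_less_lsqrt)
  moreover have "finite {x. \<psi> x \<noteq> 0}"
    using F by (rule rev_finite_subset) (auto simp: \<psi>_def)
  then have "\<psi> \<in> Domain max_laplacian"
    using laplacian_c_subset by (auto simp: laplacian_c_eq)
  ultimately show "\<exists>\<psi>\<in>Domain max_laplacian. ell2_norm (\<lambda>x. \<phi> x - \<psi> x) < \<epsilon>" by blast
qed

text \<open>Adjoints reverse inclusion, so the adjoint lies in that of
  \<open>laplacian_c adj\<close> and hence in \<open>max_laplacian\<close>. The other inclusion is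
  \<open>hop_deg_symmetric\<close>.\<close>

lemma selfadjoint_max_laplacian: "selfadjoint_op max_laplacian"
  unfolding selfadjoint_op_def
proof (intro conjI densely_defined_max_laplacian antisym)
  show "adjoint_op max_laplacian \<subseteq> max_laplacian"
    using adjoint_op_antimono[OF laplacian_c_subset] adjoint_laplacian_c_subset by blast
  have minus: "ell2_inner \<phi> (\<lambda>x. - \<psi> x) = - ell2_inner \<phi> \<psi>" for \<phi> \<psi> :: "'a \<Rightarrow> complex"
    using ell2_inner_scale_right[of \<phi> "-1" \<psi>] by simp
  have minus': "ell2_inner (\<lambda>x. - \<psi> x) \<phi> = - ell2_inner \<psi> \<phi>" for \<phi> \<psi> :: "'a \<Rightarrow> complex"
    by (subst (1 2) ell2_inner_cnj) (simp add: minus)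
  show "max_laplacian \<subseteq> adjoint_op max_laplacian"
    by (auto simp: max_laplacian_def adjoint_op_def minus minus' hop_deg_symmetric intro: ell2_uminus)
qed

text \<open>A selfadjoint extension equals its adjoint and so lies in \<open>max_laplacian\<close>.
  Taking adjoints of this inclusion of two selfadjoint operators gives the converse.\<close>

lemma laplacian_eq: "laplacian adj = max_laplacian"
  unfolding laplacian_def
proof (rule the_equality)
  show "selfadjoint_op max_laplacian \<and> laplacian_c adj \<subseteq> max_laplacian"
    using selfadjoint_max_laplacian laplacian_c_subset by blast
next
  fix A assume A: "selfadjoint_op A \<and> laplacian_c adj \<subseteq> A"
  then have "A \<subseteq> max_laplacian"
    using adjoint_op_antimono[of "laplacian_c adj" A] adjoint_laplacian_c_subset
    by (auto simp: selfadjoint_op_def)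
  moreover from this have "max_laplacian \<subseteq> A"
    using adjoint_op_antimono[of A max_laplacian] A selfadjoint_max_laplacian
    by (auto simp: selfadjoint_op_def)
  ultimately show "A = max_laplacian" by blast
qed

text \<open>A bounded potential leaves the maximal domain unchanged, and symmetry of the Laplacian
  gives uniqueness. So \<open>hop_limit\<close> applies to the columns of the finite-volume Green
  functions, and the limit is the only preimage of \<open>delta y\<close> under H - z.\<close>

lemma green_limit:
  fixes v :: "'a \<Rightarrow> real" and lam :: real
  assumes v: "\<And>x. \<bar>v x\<bar> \<le> K" and z: "Im z \<noteq> 0"
  defines "d \<equiv> \<lambda>x. of_nat (valence adj x) + of_real (lam * v x) - z"
  shows "(\<lambda>n. fgreen d (exhaustion n) x y) \<longlonglongrightarrow> green adj lam v z x y"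
proof -
  have hop_d: "hop d \<theta> x = hop deg \<theta> x + (of_real (lam * v x) - z) * \<theta> x" for \<theta> x
    by (simp add: hop_def d_def deg_def algebra_simps)
  have bdd: "cmod (of_real (lam * v x) - z) \<le> \<bar>lam\<bar> * K + cmod z" for x
    by (rule order_trans[OF norm_triangle_ineq4])
      (auto simp: norm_mult abs_mult intro!: mult_left_mono v)
  have mult: "(\<lambda>x. (of_real (lam * v x) - z) * \<theta> x) \<in> ell2" if "\<theta> \<in> ell2" for \<theta>
    using that bdd by (rule ell2_mult_bounded)
  have domain: "hop deg \<theta> \<in> ell2" if \<theta>: "\<theta> \<in> ell2" and "hop d \<theta> \<in> ell2" for \<theta>
  proof -
    have "hop deg \<theta> = (\<lambda>x. hop d \<theta> x - (of_real (lam * v x) - z) * \<theta> x)"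
      by (simp add: fun_eq_iff hop_d)
    then show ?thesis using ell2_diff[OF that(2) mult[OF \<theta>]] by simp
  qed
  have unique: "\<theta> = (\<lambda>_. 0)" if \<theta>: "\<theta> \<in> ell2" and hop0: "\<And>x. hop d \<theta> x = 0" for \<theta>
  proof -
    have "hop d \<theta> = (\<lambda>_. 0)" using hop0 by auto
    then have "hop d \<theta> \<in> ell2" by (simp add: ell2_def)
    then have dom: "hop deg \<theta> \<in> ell2" by (rule domain[OF \<theta>])
    let ?w = "\<lambda>x. (of_real (lam * v x) - z) * \<theta> x"
    have hop_deg: "hop deg \<theta> x = - ?w x" for x
      using hop0[of x] by (simp add: hop_d eq_neg_iff_add_eq_0)
    \<comment> \<open>The Laplacian is symmetric and the potential is real, so the difference of the
      two sides reduces to \<open>cnj z - z\<close> times the squared norm of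
      \<open>\<theta>\<close>.\<close>
    have "ell2_inner \<theta> (hop deg \<theta>) = ell2_inner (hop deg \<theta>) \<theta>"
      by (rule hop_deg_symmetric[OF \<theta> dom \<theta> dom])
    then have "0 = ell2_inner (hop deg \<theta>) \<theta> - ell2_inner \<theta> (hop deg \<theta>)" by simp
    also have "\<dots> = (\<Sum>\<^sub>\<infinity>x. cnj (hop deg \<theta> x) * \<theta> x + - (cnj (\<theta> x) * hop deg \<theta> x))"
      unfolding ell2_inner_def diff_conv_add_uminus infsum_uminus[symmetric]
      by (intro infsum_add[symmetric] summable_on_uminus[THEN iffD2] summable_ell2_inner \<theta> dom)
    also have "\<dots> = (\<Sum>\<^sub>\<infinity>x. of_real ((cmod (\<theta> x))\<^sup>2) * (cnj z - z))"
    proof (rule infsum_cong)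
      fix x
      show "cnj (hop deg \<theta> x) * \<theta> x + - (cnj (\<theta> x) * hop deg \<theta> x) = of_real ((cmod (\<theta> x))\<^sup>2) * (cnj z - z)"
        unfolding hop_deg complex_norm_square by (simp add: algebra_simps)
    qed
    also have "\<dots> = of_real (\<Sum>\<^sub>\<infinity>x. (cmod (\<theta> x))\<^sup>2) * (cnj z - z)"
    proof -
      have "(\<Sum>\<^sub>\<infinity>x. complex_of_real ((cmod (\<theta> x))\<^sup>2)) = of_real (\<Sum>\<^sub>\<infinity>x. (cmod (\<theta> x))\<^sup>2)"
        by (intro infsumI has_sum_of_real has_sum_infsum ell2_summable \<theta>)
      then show ?thesis by (simp only: infsum_cmult_left')
    qed
    finally have "of_real (\<Sum>\<^sub>\<infinity>x. (cmod (\<theta> x))\<^sup>2) * (cnj z - z) = 0" by simp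
    moreover have "cnj z - z \<noteq> 0" using z by (simp add: complex_eq_iff)
    ultimately have "(\<Sum>\<^sub>\<infinity>x. (cmod (\<theta> x))\<^sup>2) = 0" by simp
    then have "(cmod (\<theta> x))\<^sup>2 = 0" for x
      using \<theta> by (intro nonneg_infsum_le_0D[of "\<lambda>x. (cmod (\<theta> x))\<^sup>2" UNIV]) (auto simp: ell2_def)
    then show ?thesis by auto
  qed
  have Im_d: "Im (d x) = - Im z" for x by (simp add: d_def)
  have e: "- Im z \<noteq> 0" using z by simp
  obtain \<psi> where \<psi>: "\<psi> \<in> ell2" "\<And>x. hop d \<psi> x = delta y x"
    "\<And>x. (\<lambda>n. fgreen d (exhaustion n) x y) \<longlonglongrightarrow> \<psi> x"
    by (rule hop_limit[where d = d and e = "- Im z" and B = exhaustion and f = "delta y"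
          and \<phi> = "\<lambda>n x. fgreen d (exhaustion n) x y"])
      (assumption | rule finite_exhaustion eventually_exhaustion Im_d e ell2_delta
        fv_sol_fgreen[OF finite_exhaustion Im_d e] unique that)+
  \<comment> \<open>An exact description of the candidates for \<open>THE\<close> in
    \<open>apply_op\<close>. Membership in the Laplacian's domain follows from the equation because
    the potential is bounded.\<close>
  have mem: "(\<theta>, delta y) \<in> shift_op (anderson_op adj lam v) z \<longleftrightarrow> \<theta> \<in> ell2 \<and> hop d \<theta> = delta y" for \<theta>
  proof -
    have "shift_op (anderson_op adj lam v) z = {(\<theta>, hop d \<theta>) |\<theta>. \<theta> \<in> ell2 \<and> hop deg \<theta> \<in> ell2}"
    proof -
      have *: "hop d \<theta> = (\<lambda>x. - (- hop deg \<theta> x) + of_real (lam * v x) * \<theta> x - z * \<theta> x)" for \<theta>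
        by (simp add: fun_eq_iff hop_d algebra_simps)
      show ?thesis
        unfolding shift_op_def anderson_op_def laplacian_eq max_laplacian_def * by (auto simp: add.commute)
    qed
    then show ?thesis using domain ell2_delta[of y] by auto
  qed
  have "apply_op ((shift_op (anderson_op adj lam v) z)\<inverse>) (delta y) = \<psi>"
    unfolding apply_op_def converse_iff mem
  proof (rule the_equality)
    show "\<psi> \<in> ell2 \<and> hop d \<psi> = delta y"
      using \<psi> by auto
  next
    fix \<theta> assume \<theta>: "\<theta> \<in> ell2 \<and> hop d \<theta> = delta y"
    then have "(\<lambda>x. \<theta> x - \<psi> x) = (\<lambda>_. 0)"
      using \<psi> by (intro unique ell2_diff) (simp_all add: hop_diff)
    then show "\<theta> = \<psi>" by (simp add: fun_eq_iff)
  qed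
  then have "green adj lam v z x y = \<psi> x"
    by (simp add: green_def ell2_inner_delta)
  with \<psi>(3)[of x] show ?thesis by simp
qed

end

section \<open>The infinite volume bound\<close>

text \<open>This serves for the infinite-volume Green function, which is identified with a limit of
  measurable functions only almost surely. Subsets of the exceptional null set are measurable in the
  completion.\<close>

lemma borel_measurable_completion_AE:
  assumes g: "g \<in> M \<rightarrow>\<^sub>M N" and eq: "AE x in M. f x = g x" and f: "\<And>x. x \<in> space M \<Longrightarrow> f x \<in> space N"
  shows "f \<in> completion M \<rightarrow>\<^sub>M N"
proof (rule measurableI)
  fix A assume A: "A \<in> sets N"
  have null: "{x \<in> space M. f x \<noteq> g x \<and> Q x} \<in> sets (completion M)" for Q
  proof -
    have "AE x in M. \<not> (f x \<noteq> g x \<and> Q x)"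
      using eq by eventually_elim simp
    from sets_completion_AE[OF this] show ?thesis by (simp add: pred_def)
  qed
  have "f -` A \<inter> space M = (g -` A \<inter> space M - {x \<in> space M. f x \<noteq> g x \<and> g x \<in> A})
      \<union> {x \<in> space M. f x \<noteq> g x \<and> f x \<in> A}"
    by auto
  also have "\<dots> \<in> sets (completion M)"
    using measurable_sets[OF g A] by (intro sets.Un sets.Diff null sets_completionI_sets)
  finally show "f -` A \<inter> space (completion M) \<in> sets (completion M)" by simp
qed (use f in simp)

lemma AE_le_Linf_norm:
  assumes "Linf_norm f < \<infinity>"
  shows "AE t in lborel. f t \<le> real_of_ereal (Linf_norm f)"
proof -
  have "AE t in lborel. ereal \<bar>f t\<bar> \<le> Linf_norm f"
    unfolding Linf_norm_def by (rule esssup_AE)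
  then show ?thesis
  proof eventually_elim
    case (elim t)
    with assms show ?case by (cases "Linf_norm f") auto
  qed
qed

lemma prob_density_bound_pos:
  fixes \<rho> :: "real \<Rightarrow> real"
  assumes "prob_space (density lborel (\<lambda>t. ennreal (\<rho> t)))"
    and [measurable]: "\<rho> \<in> borel_measurable borel" and "AE t in lborel. \<rho> t \<le> N"
  shows "0 < N"
proof (rule ccontr)
  interpret prob_space "density lborel (\<lambda>t. ennreal (\<rho> t))" by fact
  assume "\<not> 0 < N"
  then have "AE t in lborel. ennreal (\<rho> t) = 0"
    using assms(3) by (auto elim!: eventually_mono simp: ennreal_eq_0_iff)
  then have "(\<integral>\<^sup>+t. ennreal (\<rho> t) \<partial>lborel) = 0"
    by (simp add: nn_integral_0_iff_AE)
  moreover have "(\<integral>\<^sup>+t. ennreal (\<rho> t) \<partial>lborel) = 1"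
    using emeasure_space_1 by (simp add: emeasure_density)
  ultimately show False by simp
qed

section \<open>From independent variables to product measures\<close>

context anderson
begin

text \<open>Independence gives the finitely many potentials in \<open>\<Lambda>\<close> the joint
  law \<open>PN \<Lambda>\<close>, and the finite-volume Green function sees only these.\<close>

lemma nn_integral_fgreen_eq:
  assumes M: "prob_space M" and indep: "prob_space.indep_vars M (\<lambda>_. borel) \<omega> UNIV"
    and distr: "\<And>v. distr M borel (\<omega> v) = \<nu>" and \<Lambda>: "finite \<Lambda>" "\<Lambda> \<noteq> {}"
  shows "(\<lambda>a. fgreen (pot (\<lambda>v. \<omega> v a)) \<Lambda> x y) \<in> borel_measurable M" (is ?meas)
    and "(\<integral>\<^sup>+a. ennreal (cmod (fgreen (pot (\<lambda>v. \<omega> v a)) \<Lambda> x y) powr s) \<partial>M) = fmom \<Lambda> x y" (is ?int)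
proof -
  interpret M: prob_space M by fact
  have rv: "\<omega> v \<in> borel_measurable M" for v
    using indep by (auto simp: M.indep_vars_def)
  define X where "X a = (\<lambda>i\<in>\<Lambda>. \<omega> i a)" for a
  have X: "X \<in> M \<rightarrow>\<^sub>M PiM \<Lambda> (\<lambda>_. borel)"
    unfolding X_def by (intro measurable_restrict rv)
  have "M.indep_vars (\<lambda>_. borel) \<omega> \<Lambda>"
    using indep by (rule M.indep_vars_subset) simp
  then have "distr M (PiM \<Lambda> (\<lambda>_. borel)) X = PN \<Lambda>"
    unfolding X_def using M.indep_vars_iff_distr_eq_PiM'[where M' = "\<lambda>_. borel" and X = \<omega>, OF \<Lambda>(2)] rv
    by (simp add: distr)
  moreover have sets: "sets (PiM \<Lambda> (\<lambda>_. borel)) = sets (PN \<Lambda>)"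
    by (intro sets_PiM_cong) auto
  ultimately have D: "distr M (PN \<Lambda>) X = PN \<Lambda>"
    by (metis distr_cong)
  have X': "X \<in> M \<rightarrow>\<^sub>M PN \<Lambda>"
    using X sets by (simp cong: measurable_cong_sets)
  have eq: "fgreen (pot (\<lambda>v. \<omega> v a)) \<Lambda> = fgreen (pot (X a)) \<Lambda>" for a
    by (rule fgreen_cong) (simp add: X_def pot_def)
  have F [measurable]: "(\<lambda>v. fgreen (pot v) \<Lambda> x y) \<in> borel_measurable (PN \<Lambda>)"
    by (rule measurable_fgreen_pot[OF \<Lambda>(1) order_refl])
  show ?meas
    unfolding eq using measurable_compose[OF X' F] .
  have "(\<lambda>v. ennreal (cmod (fgreen (pot v) \<Lambda> x y) powr s)) \<in> borel_measurable (PN \<Lambda>)"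
    by measurable
  then have "(\<integral>\<^sup>+a. ennreal (cmod (fgreen (pot (X a)) \<Lambda> x y) powr s) \<partial>M)
    = (\<integral>\<^sup>+v. ennreal (cmod (fgreen (pot v) \<Lambda> x y) powr s) \<partial>distr M (PN \<Lambda>) X)"
    by (simp add: nn_integral_distr[OF X'])
  then show ?int
    unfolding eq D fmom_def .
qed

end

theorem theorem2p2:
  fixes adj :: "'v \<Rightarrow> 'v \<Rightarrow> bool"
    and M :: "'a measure"
    and \<omega> :: "'v \<Rightarrow> 'a \<Rightarrow> real"
    and \<rho> :: "real \<Rightarrow> real"
    and lam s :: real
    and x y :: 'v
    and z :: complex
  assumes "simple_graph adj" and "infinite (UNIV :: 'v set)"
    and "locally_finite_graph adj" and "connected_graph adj"
    and "prob_space M"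
    and "prob_space.indep_vars M (\<lambda>_. borel) \<omega> UNIV"
    and "\<And>v. distributed M lborel (\<omega> v) (\<lambda>t. ennreal (\<rho> t))"
    and "AE t in lborel. 0 \<le> \<rho> t"
    and "integrable lborel \<rho>" and "Linf_norm \<rho> < \<infinity>"
    and "bounded {t. \<rho> t \<noteq> 0}"
    and "0 < lam"
    and "0 < s" and "s < 1"
    and "z \<notin> \<real>"
  shows "let C = lam powr (- s) * real_of_ereal (Linf_norm \<rho>) powr s
                   * (2 powr s * s powr (- s) / (1 - s));
             C' = 2 powr (s + 1) * C;
             f = (\<lambda>a. cmod (green adj lam (\<lambda>v. \<omega> v a) z x y) powr s)
         in integrable (completion M) f \<and>
            (\<integral>a. f a \<partial>completion M)
              \<le> C' * C ^ graph_dist adj x y * real (saw_count adj x (graph_dist adj x y))"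
proof -
  interpret M: prob_space M by fact
  let ?N = "real_of_ereal (Linf_norm \<rho>)"
  interpret conn_graph adj
    using assms(1,3,4)
    by unfold_locales (auto simp: simple_graph_def locally_finite_graph_def dest: sympD irreflpD)
  have \<rho>: "\<rho> \<in> borel_measurable borel"
    using borel_measurable_integrable[OF assms(9)] by simp
  have rv: "\<omega> v \<in> borel_measurable M" for v
    using distributed_measurable[OF assms(7)] by simp
  have distr: "distr M lborel (\<omega> v) = density lborel (\<lambda>t. ennreal (\<rho> t))" for v
    by (rule distributed_distr_eq_density[OF assms(7)])
  have prob: "prob_space (density lborel (\<lambda>t. ennreal (\<rho> t)))"
    unfolding distr[of x, symmetric] by (rule M.prob_space_distr) (simp add: rv)
  have le: "AE t in lborel. \<rho> t \<le> ?N"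
    by (rule AE_le_Linf_norm) fact
  interpret bounded_density \<rho> ?N lam s
    using \<rho> le prob_density_bound_pos[OF prob \<rho> le] assms(12-14) prob by (rule bounded_density.intro)
  interpret anderson adj \<rho> ?N lam s z
    using assms(15) by unfold_locales (simp add: complex_is_Real_iff)
  define n where "n = graph_dist adj x y"
  define f where "f a = cmod (green adj lam (\<lambda>v. \<omega> v a) z x y) powr s" for a
  define g where "g k a = cmod (fgreen (pot (\<lambda>v. \<omega> v a)) (exhaustion k) x y) powr s" for k a
  define B where "B = C\<^sub>1 * C\<^sub>0 ^ n * saw_count adj x n"
  have B: "0 \<le> B"
    using C\<^sub>0_nonneg C\<^sub>1_nonneg by (simp add: B_def)
  have distr_\<nu>: "distr M borel (\<omega> v) = \<nu>" for v
    unfolding \<nu>_def distr[of v, symmetric] by (rule distr_cong) auto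
  have nonempty: "exhaustion k \<noteq> {}" for k
    by (auto simp: exhaustion_def)
  note fg = nn_integral_fgreen_eq[OF assms(5,6) distr_\<nu> finite_exhaustion nonempty]
  have [measurable]: "g k \<in> borel_measurable M" for k
    using fg(1) unfolding g_def by measurable
  have g_le: "(\<integral>\<^sup>+a. ennreal (g k a) \<partial>M) \<le> ennreal B" for k
  proof -
    \<comment> \<open>A walk to \<open>y\<close> shorter than \<open>n\<close> would contradict the
      minimality in the distance.\<close>
    have "last xs \<noteq> y" if "j < n" "xs \<in> walks adj x j" for j xs
      using not_less_Least[of j "\<lambda>n. \<exists>xs\<in>walks adj x n. last xs = y"] that
      by (auto simp: n_def graph_dist_def)
    then have "fmom (exhaustion k) x y \<le> ennreal (C\<^sub>1 * C\<^sub>0 ^ n * card (saws (exhaustion k) x n))"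
      by (intro fmom_saws_le finite_exhaustion) auto
    also have "card (saws (exhaustion k) x n) \<le> saw_count adj x n"
      unfolding saws_def saw_count_def by (intro card_mono finite_subset[OF _ finite_walks]) auto
    then have "ennreal (C\<^sub>1 * C\<^sub>0 ^ n * card (saws (exhaustion k) x n)) \<le> ennreal B"
      unfolding B_def using C\<^sub>0_nonneg C\<^sub>1_nonneg by (intro ennreal_leI mult_left_mono) auto
    finally show ?thesis
      unfolding g_def fg(2) .
  qed
  obtain K where K: "\<And>t. \<rho> t \<noteq> 0 \<Longrightarrow> \<bar>t\<bar> \<le> K"
    using assms(11) by (auto simp: bounded_iff)
  \<comment> \<open>The support of the density bounds each variable almost surely, and countability
    of the vertices provides one null set for all of them.\<close>
  have "AE a in M. \<forall>v\<in>UNIV. \<bar>\<omega> v a\<bar> \<le> K"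
  proof (rule AE_ball_countable'[OF _ countable_vertices])
    fix v
    have "AE t in density lborel (\<lambda>t. ennreal (\<rho> t)). \<bar>t\<bar> \<le> K"
      using \<rho> K by (subst AE_density) (auto intro!: AE_I2)
    then show "AE a in M. \<bar>\<omega> v a\<bar> \<le> K"
      unfolding distr[of v, symmetric] by (rule AE_distrD[rotated]) (simp add: rv)
  qed
  then have lim: "AE a in M. (\<lambda>k. g k a) \<longlonglongrightarrow> f a"
  proof eventually_elim
    case (elim a)
    have "pot (\<lambda>v. \<omega> v a) = (\<lambda>x. of_nat (valence adj x) + of_real (lam * \<omega> x a) - z)"
      by (simp add: pot_def fun_eq_iff)
    then have "(\<lambda>k. fgreen (pot (\<lambda>v. \<omega> v a)) (exhaustion k) x y) \<longlonglongrightarrow> green adj lam (\<lambda>v. \<omega> v a) z x y"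
      using green_limit[of "\<lambda>v. \<omega> v a" K z lam x y] elim Im_z by simp
    then show ?case
      unfolding f_def g_def using s_pos
      by (intro tendsto_powr' tendsto_norm tendsto_const) auto
  qed
  \<comment> \<open>The limes inferior is measurable with respect to \<open>M\<close> itself and
    agrees with \<open>f\<close> almost surely; it carries both measurability and Fatou's
    lemma.\<close>
  define F where "F a = liminf (\<lambda>k. ennreal (g k a))" for a
  have [measurable]: "F \<in> borel_measurable M"
    unfolding F_def by measurable
  have fF: "AE a in M. ennreal (f a) = F a"
    using lim
  proof eventually_elim
    case (elim a)
    then have "(\<lambda>k. ennreal (g k a)) \<longlonglongrightarrow> ennreal (f a)"
      by (intro tendsto_ennrealI)
    then show ?case
      unfolding F_def by (intro lim_imp_Liminf[symmetric]) auto
  qed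
  have f_nonneg: "0 \<le> f a" for a by (simp add: f_def)
  have f_meas: "f \<in> borel_measurable (completion M)"
  proof (rule borel_measurable_completion_AE)
    show "(\<lambda>a. enn2real (F a)) \<in> borel_measurable M" by measurable
    show "AE a in M. f a = enn2real (F a)"
      using fF by eventually_elim (metis enn2real_ennreal f_nonneg)
  qed simp
  have "(\<integral>\<^sup>+a. ennreal (f a) \<partial>completion M) = (\<integral>\<^sup>+a. ennreal (f a) \<partial>M)"
    by (rule nn_integral_completion)
  also have "\<dots> = (\<integral>\<^sup>+a. F a \<partial>M)"
    by (rule nn_integral_cong_AE[OF fF])
  also have "\<dots> \<le> liminf (\<lambda>k. \<integral>\<^sup>+a. ennreal (g k a) \<partial>M)"
    unfolding F_def by (rule nn_integral_liminf) measurable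
  also have "\<dots> \<le> limsup (\<lambda>k. \<integral>\<^sup>+a. ennreal (g k a) \<partial>M)"
    by (rule Liminf_le_Limsup) simp
  also have "\<dots> \<le> ennreal B"
    using g_le by (intro Limsup_bounded) auto
  finally have bound: "(\<integral>\<^sup>+a. ennreal (f a) \<partial>completion M) \<le> ennreal B" .
  have "integrable (completion M) f"
    using f_meas bound f_nonneg
    by (intro integrableI_nonneg) (auto intro: le_less_trans ennreal_less_top)
  moreover have "(\<integral>a. f a \<partial>completion M) \<le> B"
    using integral_eq_nn_integral[OF f_meas] f_nonneg bound B
    by (simp add: enn2real_leI)
  ultimately show ?thesis
    unfolding Let_def f_def B_def C\<^sub>1_def C\<^sub>0_def n_def by blast
qed

end
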